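(* Let $\mathbb{F}$ be a finite field. The collection $\{\mathbb{P}: \mathbb{P}\text{ is a partial field and there is a partial-field homomorphism } \mathbb{P}\to\mathbb{F}\}$ is not well-quasi-ordered under the relation $\succeq_{\mathrm{Hom}}$.
   Context: A partial field is a pair $\mathbb{P}=(R,G)$ with $R$ a commutative ring with unity and $G$ a subgroup of $R^\times$ with $-1\in G$; elements of $\mathbb{P}$ are $0$ and the elements of $G$. A partial-field homomorphism $\phi:\mathbb{P}_1\to\mathbb{P}_2$ is a map on elements with $\phi(1)=1$, $\phi(pq)=\phi(p)\phi(q)$, and $\phi(p)+\phi(q)=\phi(r)$ whenever $p,q,r\in\mathbb{P}_1$ with $p+q=r$. The field $\mathbb{F}$ is regarded as the partial field $(\mathbb{F},\mathbb{F}^\times)$. Write $\mathbb{P}_2\succeq_{\mathrm{Hom}}\mathbb{P}_1$ if there is a partial-field homomorphism $\mathbb{P}_1\to\mathbb{P}_2$. A relation $\succeq$ on a collection $P$ is a well-quasi-ordering if it is reflexive, transitive, and for every infinite sequence $a_1,a_2,\dots$ in $P$ there exist $i>j$ with $a_i\succeq a_j$. *)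

theory Defs
  imports "HOL-Algebra.Algebra"
begin

type_synonym 'a partial_field = "'a ring \<times> 'a set"

definition partial_field :: "'a partial_field \<Rightarrow> bool" where
  "partial_field P \<longleftrightarrow>
     (case P of (R, G) \<Rightarrow> cring R \<and> subgroup G (units_of R) \<and> \<ominus>\<^bsub>R\<^esub> \<one>\<^bsub>R\<^esub> \<in> G)"

definition pf_elems :: "'a partial_field \<Rightarrow> 'a set" where
  "pf_elems P = (case P of (R, G) \<Rightarrow> insert \<zero>\<^bsub>R\<^esub> G)"

text \<open>Sums of elements of a partial field are formed in the ring and need not be elements again.
  Values of \<open>\<phi>\<close> outside the elements of the source are irrelevant.\<close>

definition pf_hom :: "'a partial_field \<Rightarrow> 'b partial_field \<Rightarrow> ('a \<Rightarrow> 'b) \<Rightarrow> bool" where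
  "pf_hom P1 P2 \<phi> \<longleftrightarrow>
     \<phi> \<in> pf_elems P1 \<rightarrow> pf_elems P2 \<and>
     \<phi> \<one>\<^bsub>fst P1\<^esub> = \<one>\<^bsub>fst P2\<^esub> \<and>
     (\<forall>p \<in> pf_elems P1. \<forall>q \<in> pf_elems P1. \<phi> (p \<otimes>\<^bsub>fst P1\<^esub> q) = \<phi> p \<otimes>\<^bsub>fst P2\<^esub> \<phi> q) \<and>
     (\<forall>p \<in> pf_elems P1. \<forall>q \<in> pf_elems P1. \<forall>r \<in> pf_elems P1.
        p \<oplus>\<^bsub>fst P1\<^esub> q = r \<longrightarrow> \<phi> p \<oplus>\<^bsub>fst P2\<^esub> \<phi> q = \<phi> r)"

definition pf_of_field :: "'a ring \<Rightarrow> 'a partial_field" where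
  "pf_of_field F = (F, Units F)"

definition hom_ge :: "'b partial_field \<Rightarrow> 'a partial_field \<Rightarrow> bool" (infix "\<succeq>\<^sub>H\<^sub>o\<^sub>m" 50) where
  "P2 \<succeq>\<^sub>H\<^sub>o\<^sub>m P1 \<longleftrightarrow> (\<exists>\<phi>. pf_hom P1 P2 \<phi>)"

definition wqo_on :: "'p set \<Rightarrow> ('p \<Rightarrow> 'p \<Rightarrow> bool) \<Rightarrow> bool" where
  "wqo_on P ge \<longleftrightarrow>
     reflp_on P ge \<and> transp_on P ge \<and>
     (\<forall>a :: nat \<Rightarrow> 'p. range a \<subseteq> P \<longrightarrow> (\<exists>i j. j < i \<and> ge (a i) (a j)))"

lemma hom_ge_refl: "P \<succeq>\<^sub>H\<^sub>o\<^sub>m P"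
  unfolding hom_ge_def pf_hom_def by (intro exI[of _ "\<lambda>x. x"]) auto

lemma hom_ge_trans:
  assumes "P3 \<succeq>\<^sub>H\<^sub>o\<^sub>m P2" and "P2 \<succeq>\<^sub>H\<^sub>o\<^sub>m P1"
  shows "P3 \<succeq>\<^sub>H\<^sub>o\<^sub>m P1"
proof -
  obtain f g where "pf_hom P1 P2 f" "pf_hom P2 P3 g"
    using assms unfolding hom_ge_def by blast
  then have "pf_hom P1 P3 (\<lambda>x. g (f x))"
    unfolding pf_hom_def Pi_iff by metis
  then show ?thesis
    unfolding hom_ge_def by blast
qed

text \<open>The partial fields admitting a homomorphism to a field form a proper class; here it is cut down
  to the rings whose carrier lies in the type \<open>'a\<close>. Every ring of cardinality at most that of
  \<open>'a\<close> has an isomorphic copy there, so \<open>'a\<close> plays the role of a universe.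
  It has to be large enough. A partial field mapping to the field with two elements satisfies no
  relation \<open>p + q = r\<close> between nonzero elements, so only the group and \<open>-1\<close> matter, and groups of
  size continuum are used to get a bad sequence; universes are therefore required to have at least
  that cardinality.\<close>

definition pf_over :: "'b ring \<Rightarrow> 'a partial_field set" where
  "pf_over F = {P. partial_field P \<and> (\<exists>\<phi>. pf_hom P (pf_of_field F) \<phi>)}"

end

theory Submission
  imports Defs Complex_Main "HOL-Library.Function_Algebras" "HOL-Library.Countable"
    "HOL-Library.Infinite_Set" "HOL-Computational_Algebra.Primes"
begin

text \<open>
  In both cases the rings are copies of \<open>\<complex>\<^sup>\<nat>\<close> and only the groups vary.

  If \<open>2 \<noteq> 0\<close> in \<open>F\<close>, let \<open>\<zeta>\<close> be a primitive \<open>p\<close>-th root of unity for an odd prime \<open>p\<close>, put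
  \<open>x = (1, \<zeta>, \<zeta>, \<dots>)\<close> and let \<open>G\<^sub>p\<close> be generated by \<open>-1\<close>, \<open>x\<close> and \<open>1 + x\<close>. Coordinate 0 maps
  \<open>G\<^sub>p\<close> to \<open>F\<close>. Under a homomorphism to \<open>G\<^sub>q\<close> the image of \<open>x\<close> has order dividing \<open>p\<close>, hence is 1 for
  \<open>q \<noteq> p\<close>, and then \<open>1 + 1 \<in> G\<^sub>q\<close>, which fails because \<open>\<bar>1 + \<zeta>\<bar> < 2\<close>.

  If \<open>2 = 0\<close> in \<open>F\<close>, only the group and \<open>-1\<close> matter. Let \<open>K\<close> be the group of all \<open>x \<in> \<int>\<^sup>\<nat>\<close> with
  \<open>2 ^ n dvd x n\<close>, let \<open>\<chi>\<close> be a character of \<open>\<int>\<^sup>\<nat>\<close> with \<open>\<chi> = 1\<close> on \<open>2 K\<close>, and let \<open>G\<close> be the quotient of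
  \<open>\<int>\<^sup>\<nat>\<close> by the kernel of \<open>\<chi>\<close> on \<open>K\<close>, with \<open>-1\<close> the class of the \<open>k \<in> K\<close> with \<open>\<chi> k = -1\<close>. It embeds in the
  units of \<open>\<complex>\<^sup>\<nat>\<close> by \<open>x \<mapsto> \<chi> x * cis (2 * pi * x n / 2 ^ n)\<close>. A homomorphism between two such groups that
  preserves \<open>-1\<close> is determined on \<open>K\<close> by the images of the unit vectors, so there are only continuum many
  candidates, while \<open>K / 2 K\<close> has continuum many elements: by transfinite recursion one finds
  countably many characters \<open>\<chi>\<^sub>i\<close> that defeat every candidate between any two of them.
\<close>

section \<open>Characters with prescribed signs\<close>

lemma card_Fpow_ordLess:
  assumes "|A| <o |B|" and "infinite B"
  shows "|Fpow A| <o |B|"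
proof (cases "finite A")
  case True
  then have "finite (Fpow A)"
    by (simp add: Fpow_def)
  then show ?thesis
    using assms(2) by (rule finite_ordLess_infinite2)
next
  case False
  then show ?thesis
    using assms(1) card_of_Fpow_infinite ordIso_ordLess_trans by blast
qed

text \<open>Choose along a well-order of \<open>Q\<close> of minimal length: the sums over finite subsets of an initial
  segment are too few to meet all classes of \<open>w q\<close>.\<close>

lemma independent_transversal:
  fixes w :: "'q \<Rightarrow> 's \<Rightarrow> 'w::ab_group_add"
  assumes card: "|Q| \<le>o |UNIV :: 's set|" and inf: "infinite (UNIV :: 's set)"
    and diff: "\<And>a b. a \<in> N \<Longrightarrow> b \<in> N \<Longrightarrow> a - b \<in> N"
    and inj: "\<And>q s s'. q \<in> Q \<Longrightarrow> w q s - w q s' \<in> N \<Longrightarrow> s = s'"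
  shows "\<exists>\<sigma>. \<forall>A. finite A \<longrightarrow> A \<subseteq> Q \<longrightarrow> A \<noteq> {} \<longrightarrow> (\<Sum>q\<in>A. w q (\<sigma> q)) \<notin> N"
proof -
  let ?r = "|Q|"
  have wo: "Well_order ?r" and F: "Field ?r = Q"
    by simp_all
  then have wf: "wf (?r - Id)"
    using well_order_on_def by blast
  \<comment> \<open>\<open>P f q s\<close>: with \<open>s\<close> chosen at \<open>q\<close>, no
    finite sum of earlier choices brings \<open>w q s\<close> into \<open>N\<close>. Only values of
    \<open>f\<close> below \<open>q\<close> enter, as the recursion requires.\<close>
  define P where "P f q s \<longleftrightarrow> q \<in> Q \<longrightarrow> (\<forall>A\<in>Fpow (underS ?r q). w q s + (\<Sum>p\<in>A. w p (f p)) \<notin> N)"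
    for f q s
  have "\<exists>\<sigma>. \<forall>q. P \<sigma> q (\<sigma> q)"
  proof (rule dependent_wf_choice[OF wf])
    fix f g :: "'q \<Rightarrow> 's" and q s
    assume fg: "\<And>z. (z, q) \<in> ?r - Id \<Longrightarrow> f z = g z"
    have "(\<Sum>p\<in>A. w p (f p)) = (\<Sum>p\<in>A. w p (g p))" if "A \<in> Fpow (underS ?r q)" for A
      using that by (intro sum.cong) (auto simp: Fpow_def underS_def fg)
    then show "P f q s = P g q s"
      unfolding P_def by auto
  next
    fix q and f :: "'q \<Rightarrow> 's"
    show "\<exists>s. P f q s"
    proof (rule ccontr)
      assume "\<nexists>s. P f q s"
      then have q: "q \<in> Q"
        and "\<forall>s. \<exists>A. A \<in> Fpow (underS ?r q) \<and> w q s + (\<Sum>p\<in>A. w p (f p)) \<in> N"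
        unfolding P_def by blast+
      then obtain A where A: "\<And>s. A s \<in> Fpow (underS ?r q)"
        and N: "\<And>s. w q s + (\<Sum>p\<in>A s. w p (f p)) \<in> N"
        by metis
      \<comment> \<open>If every \<open>s\<close> fails at \<open>q\<close>, each comes with a
        finite set \<open>A s\<close> of predecessors. Equal sets would put
        \<open>w q s - w q s'\<close> into \<open>N\<close>, so there would be as many finite sets
        as candidates \<open>s\<close>; but a proper initial segment of a cardinal order is too
        small for that.\<close>
      have "inj A"
      proof (rule injI)
        fix s s' assume "A s = A s'"
        then have "w q s - w q s' \<in> N"
          using diff[OF N[of s] N[of s']] by simp
        then show "s = s'"
          using inj q by blast
      qed
      then have "|UNIV :: 's set| \<le>o |Fpow (underS ?r q)|"
        using A card_of_ordLeq by blast
      moreover have "|underS ?r q| <o |UNIV :: 's set|"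
        using card_of_underS[OF card_of_Card_order, of q Q] card q F ordLess_ordLeq_trans by metis
      then have "|Fpow (underS ?r q)| <o |UNIV :: 's set|"
        using inf by (rule card_Fpow_ordLess)
      ultimately show False
        using not_ordLess_ordLeq by blast
    qed
  qed
  then obtain \<sigma> where \<sigma>: "\<And>q. P \<sigma> q (\<sigma> q)"
    by blast
  have "(\<Sum>q\<in>A. w q (\<sigma> q)) \<notin> N" if A: "finite A" "A \<subseteq> Q" "A \<noteq> {}" for A
  proof -
    \<comment> \<open>The last element \<open>m\<close> of \<open>A\<close> was chosen against all
      finite sets of predecessors, among them \<open>A - {m}\<close>.\<close>
    have "\<exists>m\<in>A. \<forall>p\<in>A. (p, m) \<in> ?r"
      using A(1,3,2)
    proof (induction rule: finite_ne_induct)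
      case (singleton x)
      then show ?case
        using wo F by (auto simp: order_on_defs refl_on_def)
    next
      case (insert x A)
      then obtain m where m: "m \<in> A" "\<forall>p\<in>A. (p, m) \<in> ?r"
        by auto
      then have "m \<in> Q" "x \<in> Q" "x \<noteq> m"
        using insert by auto
      then have "(x, x) \<in> ?r" "(x, m) \<in> ?r \<or> (m, x) \<in> ?r"
        using wo F by (auto simp: order_on_defs refl_on_def total_on_def)
      moreover have "trans ?r"
        using wo by (auto simp: order_on_defs)
      ultimately show ?case
        using m by (metis insert_iff transD)
    qed
    then obtain m where m: "m \<in> A" "\<forall>p\<in>A. (p, m) \<in> ?r"
      by blast
    then have "A - {m} \<in> Fpow (underS ?r m)"
      using A by (auto simp: Fpow_def underS_def)
    then have "w m (\<sigma> m) + (\<Sum>p\<in>A - {m}. w p (\<sigma> p)) \<notin> N"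
      using \<sigma>[of m] m A unfolding P_def by blast
    then show ?thesis
      using A m by (simp add: sum.remove)
  qed
  then show ?thesis
    by blast
qed

section \<open>Characters with values in the nonzero complex numbers\<close>

text \<open>A homomorphism on a subgroup, given by its graph: a subgroup of the product whose fibre
  over 0 is trivial, which makes it single-valued. As sets of pairs, partial homomorphisms are
  ordered by inclusion and chains have their unions as bounds.\<close>

definition graph_hom :: "('a::ring_1 \<times> complex) set \<Rightarrow> bool" where
  "graph_hom \<Gamma> \<longleftrightarrow> (0, 1) \<in> \<Gamma> \<and>
     (\<forall>a z b y. (a, z) \<in> \<Gamma> \<longrightarrow> (b, y) \<in> \<Gamma> \<longrightarrow> (a - b, z / y) \<in> \<Gamma>) \<and>
     (\<forall>a z. (a, z) \<in> \<Gamma> \<longrightarrow> z \<noteq> 0) \<and> (\<forall>z. (0, z) \<in> \<Gamma> \<longrightarrow> z = 1)"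

lemma graph_hom_diff: "graph_hom \<Gamma> \<Longrightarrow> (a, z) \<in> \<Gamma> \<Longrightarrow> (b, y) \<in> \<Gamma> \<Longrightarrow> (a - b, z / y) \<in> \<Gamma>"
  and graph_hom_zero: "graph_hom \<Gamma> \<Longrightarrow> (0, 1) \<in> \<Gamma>"
  and graph_hom_nz: "graph_hom \<Gamma> \<Longrightarrow> (a, z) \<in> \<Gamma> \<Longrightarrow> z \<noteq> 0"
  and graph_hom_zeroD: "graph_hom \<Gamma> \<Longrightarrow> (0, z) \<in> \<Gamma> \<Longrightarrow> z = 1"
  unfolding graph_hom_def by blast+

lemma graph_hom_add:
  assumes "graph_hom \<Gamma>" "(a, z) \<in> \<Gamma>" "(b, y) \<in> \<Gamma>"
  shows "(a + b, z * y) \<in> \<Gamma>"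
  using graph_hom_diff[OF assms(1,2) graph_hom_diff[OF assms(1) graph_hom_zero[OF assms(1)] assms(3)]]
  by simp

lemma graph_hom_unique:
  assumes "graph_hom \<Gamma>" "(a, z) \<in> \<Gamma>" "(a, y) \<in> \<Gamma>"
  shows "z = y"
proof -
  have "(0, z / y) \<in> \<Gamma>"
    using graph_hom_diff[OF assms] by simp
  then show ?thesis
    using graph_hom_zeroD assms graph_hom_nz by fastforce
qed

lemma graph_hom_of_int:
  assumes "graph_hom \<Gamma>" "(a, z) \<in> \<Gamma>"
  shows "(of_int n * a, z powi n) \<in> \<Gamma>"
proof (induction n rule: int_induct[where k = 0])
  case base
  then show ?case
    using graph_hom_zero[OF assms(1)] by simp
next
  case (step1 i)
  then show ?case
    using graph_hom_add[OF assms(1) step1(2) assms(2)] graph_hom_nz[OF assms]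
    by (simp add: power_int_add algebra_simps)
next
  case (step2 i)
  then show ?case
    using graph_hom_diff[OF assms(1) step2(2) assms(2)] graph_hom_nz[OF assms]
    by (simp add: power_int_diff algebra_simps)
qed

text \<open>Remainders on division by the least positive member are again members, hence
  zero.\<close>

lemma int_subgroup_principal:
  fixes I :: "int set"
  assumes "0 \<in> I" "\<And>a b. a \<in> I \<Longrightarrow> b \<in> I \<Longrightarrow> a - b \<in> I"
  shows "\<exists>m\<in>I. \<forall>n\<in>I. m dvd n"
proof (cases "I \<subseteq> {0}")
  case True
  then show ?thesis using assms by auto
next
  case False
  then obtain a where a: "a \<in> I" "a \<noteq> 0" by blast
  have neg: "- b \<in> I" if "b \<in> I" for b
    using assms that by (metis diff_0)
  have add: "b + c \<in> I" if "b \<in> I" "c \<in> I" for b c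
    using assms(2)[OF that(1) neg[OF that(2)]] by simp
  have ex: "\<exists>k. k > 0 \<and> int k \<in> I"
    using a neg[OF a(1)] by (intro exI[of _ "nat \<bar>a\<bar>"]) (auto simp: abs_if)
  define k where "k = (LEAST k. k > 0 \<and> int k \<in> I)"
  have k: "k > 0" "int k \<in> I"
    using LeastI_ex[OF ex] unfolding k_def by auto
  have min: "k \<le> l" if "l > 0" "int l \<in> I" for l
    unfolding k_def using that by (intro Least_le) auto
  have mult: "int n * int k \<in> I" for n
    by (induction n) (auto simp: assms algebra_simps intro: add k)
  have mult': "n * int k \<in> I" for n :: int
  proof (cases "n \<ge> 0")
    case True
    then show ?thesis using mult[of "nat n"] by simp
  next
    case False
    then show ?thesis using neg[OF mult[of "nat (- n)"]] by simp
  qed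
  have "int k dvd n" if "n \<in> I" for n
  proof (rule ccontr)
    assume "\<not> int k dvd n"
    then have "n mod int k \<noteq> 0"
      by (simp add: dvd_eq_mod_eq_0)
    then have pos: "n mod int k > 0"
      using k pos_mod_sign[of "int k" n] by linarith
    have "n mod int k \<in> I"
      using assms(2)[OF that mult'[of "n div int k"]] by (simp add: minus_div_mult_eq_mod)
    then have "k \<le> nat (n mod int k)"
      using min pos by simp
    then show False
      using k pos_mod_bound[of "int k" n] by linarith
  qed
  then show ?thesis using k by blast
qed

text \<open>The nonzero complex numbers form a divisible, hence injective, abelian group. The ring
  structure on the source is only there to write integer multiples.\<close>

lemma graph_hom_extend:
  assumes "graph_hom \<Gamma>\<^sub>0"
  shows "\<exists>\<chi>. (\<forall>a. \<chi> a \<noteq> 0) \<and> (\<forall>a b. \<chi> (a + b) = \<chi> a * \<chi> b) \<and> (\<forall>(a, z)\<in>\<Gamma>\<^sub>0. \<chi> a = z)"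
proof -
  define \<A> where "\<A> = {\<Gamma>. graph_hom \<Gamma> \<and> \<Gamma>\<^sub>0 \<subseteq> \<Gamma>}"
  have "\<exists>M\<in>\<A>. \<forall>A\<in>\<A>. M \<subseteq> A \<longrightarrow> A = M"
  proof (rule subset_Zorn_nonempty)
    show "\<A> \<noteq> {}"
      using assms by (auto simp: \<A>_def)
    fix \<C> assume C: "\<C> \<noteq> {}" "subset.chain \<A> \<C>"
    then have sub: "\<And>A. A \<in> \<C> \<Longrightarrow> graph_hom A \<and> \<Gamma>\<^sub>0 \<subseteq> A"
      by (auto simp: subset.chain_def \<A>_def)
    have "(a - b, z / y) \<in> \<Union>\<C>" if ab: "(a, z) \<in> \<Union>\<C>" "(b, y) \<in> \<Union>\<C>" for a z b y
    proof -
      obtain A Y where "A \<in> \<C>" "(a, z) \<in> A" "Y \<in> \<C>" "(b, y) \<in> Y"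
        using ab by blast
      moreover from this have "A \<subseteq> Y \<or> Y \<subseteq> A"
        using C(2) by (auto simp: subset_chain_def)
      ultimately obtain Z where "Z \<in> \<C>" "(a, z) \<in> Z" "(b, y) \<in> Z"
        by blast
      then show ?thesis
        using sub graph_hom_diff by blast
    qed
    then have "graph_hom (\<Union>\<C>)"
      unfolding graph_hom_def using C(1) sub graph_hom_zero graph_hom_nz graph_hom_zeroD
      by (intro conjI allI impI) blast+
    then show "\<Union>\<C> \<in> \<A>"
      using C(1) sub by (auto simp: \<A>_def)
  qed
  then obtain M where "M \<in> \<A>" and maximal: "\<forall>A\<in>\<A>. M \<subseteq> A \<longrightarrow> A = M" ..
  then have M: "graph_hom M" "\<Gamma>\<^sub>0 \<subseteq> M"
    by (simp_all add: \<A>_def)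
  have max: "A = M" if "graph_hom A" "M \<subseteq> A" for A
    using maximal that M(2) unfolding \<A>_def by (metis (mono_tags) mem_Collect_eq subset_trans)
  have "\<exists>z. (a, z) \<in> M" for a
  proof -
    \<comment> \<open>\<open>I\<close> collects the multiples of \<open>a\<close> already in the
      domain of \<open>M\<close>. With generator \<open>m\<close>, the value at \<open>a\<close>
      must be an \<open>m\<close>-th root of the value \<open>c\<close> at
      \<open>of_int m * a\<close>; for \<open>m = 0\<close> the value 1 is taken.\<close>
    define I where "I = {n :: int. \<exists>z. (of_int n * a, z) \<in> M}"
    have "\<exists>m\<in>I. \<forall>n\<in>I. m dvd n"
    proof (rule int_subgroup_principal)
      show "0 \<in> I"
        using graph_hom_zero[OF M(1)] by (auto simp: I_def)
      show "k - l \<in> I" if "k \<in> I" "l \<in> I" for k l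
        using that graph_hom_diff[OF M(1)] unfolding I_def
        by (fastforce simp: left_diff_distrib)
    qed
    then obtain m c where m: "(of_int m * a, c) \<in> M" and dvd: "\<And>n. n \<in> I \<Longrightarrow> m dvd n"
      unfolding I_def by blast
    have "c \<noteq> 0"
      using graph_hom_nz M(1) m by blast
    have "\<exists>y. y \<noteq> 0 \<and> y powi m = c"
    proof (cases "m = 0")
      case True
      then have "c = 1"
        using m graph_hom_zeroD M(1) by fastforce
      then show ?thesis
        using True by (intro exI[of _ 1]) auto
    next
      case False
      \<comment> \<open>A logarithm of \<open>c\<close>; dividing it by \<open>m\<close> yields the
        root.\<close>
      define l where "l = complex_of_real (ln (cmod c)) + \<i> * of_real (Arg c)"
      have l: "exp l = c"
        unfolding l_def exp_add exp_of_real cis_conv_exp[symmetric]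
        using \<open>c \<noteq> 0\<close> rcis_cmod_Arg[of c] by (simp add: rcis_def)
      have "exp (l / of_int m) powi m = exp (of_int m * (l / of_int m))"
        by (simp add: exp_power_int)
      then show ?thesis
        using False l by (intro exI[of _ "exp (l / of_int m)"]) auto
    qed
    then obtain y where y: "y \<noteq> 0" "y powi m = c"
      by blast
    define \<Gamma> where "\<Gamma> = {(of_int n * a + h, y powi n * z) | n h z. (h, z) \<in> M}"
    have "graph_hom \<Gamma>"
      unfolding graph_hom_def
    proof (intro conjI allI impI)
      show "(0, 1) \<in> \<Gamma>"
        unfolding \<Gamma>_def using graph_hom_zero[OF M(1)] by (auto intro!: exI[of _ "0::int"])
    next
      fix b u b' u' assume "(b, u) \<in> \<Gamma>" "(b', u') \<in> \<Gamma>"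
      then obtain n h z n' h' z' where *: "b = of_int n * a + h" "u = y powi n * z" "(h, z) \<in> M"
        "b' = of_int n' * a + h'" "u' = y powi n' * z'" "(h', z') \<in> M"
        unfolding \<Gamma>_def by blast
      then have "(h - h', z / z') \<in> M"
        using graph_hom_diff M(1) by blast
      moreover have "b - b' = of_int (n - n') * a + (h - h')"
        using * by (simp add: algebra_simps)
      moreover have "u / u' = y powi (n - n') * (z / z')"
        using * y by (simp add: power_int_diff)
      ultimately show "(b - b', u / u') \<in> \<Gamma>"
        unfolding \<Gamma>_def by blast
    next
      fix b u assume "(b, u) \<in> \<Gamma>"
      then show "u \<noteq> 0"
        unfolding \<Gamma>_def using y(1) graph_hom_nz[OF M(1)] by auto
    next
      fix u assume "(0, u) \<in> \<Gamma>"
      then obtain n h z where *: "of_int n * a + h = 0" "u = y powi n * z" "(h, z) \<in> M"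
        unfolding \<Gamma>_def by auto
      \<comment> \<open>Single-valuedness: \<open>h\<close> is a multiple of \<open>a\<close> in the
        domain of \<open>M\<close>, so \<open>m dvd - n\<close>, its value is a power of
        \<open>c = y powi m\<close>, and this cancels \<open>y powi n\<close>.\<close>
      then have h: "h = of_int (- n) * a"
        by (simp add: eq_neg_iff_add_eq_0 add.commute)
      then have "m dvd - n"
        using dvd[of "- n"] * unfolding I_def by blast
      then obtain k where k: "- n = m * k" by blast
      then have "h = of_int k * (of_int m * a)"
        unfolding h by (metis mult.assoc mult.commute of_int_mult)
      then have "z = c powi k"
        using graph_hom_of_int[OF M(1) m, of k] *(3) graph_hom_unique[OF M(1)] by simp
      also have "\<dots> = y powi (- n)"
        by (simp add: k power_int_mult y)
      finally show "u = 1"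
        using * y by (simp add: power_int_minus)
    qed
    moreover have "M \<subseteq> \<Gamma>"
      unfolding \<Gamma>_def by (force intro!: exI[of _ "0::int"])
    ultimately have "\<Gamma> = M"
      by (rule max)
    moreover have "(a, y) \<in> \<Gamma>"
      unfolding \<Gamma>_def using graph_hom_zero[OF M(1)] by (force intro!: exI[of _ "1::int"])
    ultimately show ?thesis by blast
  qed
  then obtain \<chi> where \<chi>: "\<And>a. (a, \<chi> a) \<in> M" by metis
  have "\<chi> (a + b) = \<chi> a * \<chi> b" for a b
    using graph_hom_unique[OF M(1) \<chi> graph_hom_add[OF M(1) \<chi>[of a] \<chi>[of b]]] .
  moreover have "\<chi> a \<noteq> 0" for a
    using graph_hom_nz[OF M(1) \<chi>] .
  moreover have "\<chi> a = z" if "(a, z) \<in> \<Gamma>\<^sub>0" for a z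
    using graph_hom_unique[OF M(1) \<chi>] that M(2) by blast
  ultimately show ?thesis by blast
qed

text \<open>Modulo \<open>N\<close> the \<open>v q\<close> are a basis of an elementary abelian
  2-group, so the parity of the number of summands is a character on the subgroup generated by
  \<open>N\<close> and the \<open>v q\<close>; it then extends to the whole group.\<close>

lemma sign_character:
  fixes v :: "'q \<Rightarrow> 'w::ring_1"
  assumes zero: "0 \<in> N" and diff: "\<And>a b. a \<in> N \<Longrightarrow> b \<in> N \<Longrightarrow> a - b \<in> N"
    and dbl: "\<And>q. q \<in> Q \<Longrightarrow> v q + v q \<in> N"
    and indep: "\<And>A. finite A \<Longrightarrow> A \<subseteq> Q \<Longrightarrow> A \<noteq> {} \<Longrightarrow> (\<Sum>q\<in>A. v q) \<notin> N"
  shows "\<exists>\<chi> :: 'w \<Rightarrow> complex. (\<forall>a. \<chi> a \<noteq> 0) \<and> (\<forall>a b. \<chi> (a + b) = \<chi> a * \<chi> b) \<and>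
           (\<forall>a\<in>N. \<chi> a = 1) \<and> (\<forall>q\<in>Q. \<chi> (v q) = -1)"
proof -
  define \<Gamma> where "\<Gamma> = {(h, (-1) ^ card A :: complex) | h A. finite A \<and> A \<subseteq> Q \<and> h - (\<Sum>q\<in>A. v q) \<in> N}"
  have neg: "- a \<in> N" if "a \<in> N" for a
    using diff[OF zero that] by simp
  have add: "a + b \<in> N" if "a \<in> N" "b \<in> N" for a b
    using diff[OF that(1) neg[OF that(2)]] by simp
  have dbl_sum: "(\<Sum>q\<in>A. v q) + (\<Sum>q\<in>A. v q) \<in> N" if "finite A" "A \<subseteq> Q" for A
    unfolding sum.distrib[symmetric] using that
    by (induction A rule: finite_induct) (auto intro: zero add dbl)
  have "graph_hom \<Gamma>"
    unfolding graph_hom_def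
  proof (intro conjI allI impI)
    show "(0, 1) \<in> \<Gamma>"
      unfolding \<Gamma>_def using zero by (auto intro!: exI[of _ "{}"])
  next
    fix a z b y assume "(a, z) \<in> \<Gamma>" "(b, y) \<in> \<Gamma>"
    then obtain A B where A: "finite A" "A \<subseteq> Q" "a - (\<Sum>q\<in>A. v q) \<in> N" "z = (-1) ^ card A"
      and B: "finite B" "B \<subseteq> Q" "b - (\<Sum>q\<in>B. v q) \<in> N" "y = (-1) ^ card B"
      unfolding \<Gamma>_def by blast
    \<comment> \<open>Common summands cancel in the difference, and \<open>v q\<close> equals its
      negative modulo \<open>N\<close>, so the symmetric difference represents
      \<open>a - b\<close>.\<close>
    define D where "D = (A - B) \<union> (B - A)"
    have sA: "(\<Sum>q\<in>A. v q) = (\<Sum>q\<in>A - B. v q) + (\<Sum>q\<in>A \<inter> B. v q)"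
      using A(1) by (metis add.commute sum.Int_Diff)
    have sB: "(\<Sum>q\<in>B. v q) = (\<Sum>q\<in>B - A. v q) + (\<Sum>q\<in>A \<inter> B. v q)"
      using B(1) by (metis add.commute sum.Int_Diff Int_commute)
    have sD: "(\<Sum>q\<in>D. v q) = (\<Sum>q\<in>A - B. v q) + (\<Sum>q\<in>B - A. v q)"
      unfolding D_def using A(1) B(1) by (intro sum.union_disjoint) auto
    have "(a - b) - (\<Sum>q\<in>D. v q) =
        ((a - (\<Sum>q\<in>A. v q)) - (b - (\<Sum>q\<in>B. v q))) - ((\<Sum>q\<in>B - A. v q) + (\<Sum>q\<in>B - A. v q))"
      unfolding sA sB sD by (simp add: algebra_simps)
    also have "\<dots> \<in> N"
      by (rule diff[OF diff[OF A(3) B(3)] dbl_sum]) (use B in auto)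
    finally have "(a - b) - (\<Sum>q\<in>D. v q) \<in> N" .
    moreover have "finite D" "D \<subseteq> Q"
      using A B by (auto simp: D_def)
    moreover have "z / y = (-1) ^ card D"
    proof -
      have "card A = card (A - B) + card (A \<inter> B)" "card B = card (B - A) + card (A \<inter> B)"
        using A(1) B(1) card_Int_Diff[of A B] card_Int_Diff[of B A] by (auto simp: Int_commute)
      moreover have "card D = card (A - B) + card (B - A)"
        unfolding D_def using A(1) B(1) by (intro card_Un_disjoint) auto
      ultimately show ?thesis
        unfolding A B by (simp add: power_add field_simps flip: power_mult_distrib)
    qed
    ultimately show "(a - b, z / y) \<in> \<Gamma>"
      unfolding \<Gamma>_def by blast
  next
    fix a z assume "(a, z) \<in> \<Gamma>"
    then show "z \<noteq> 0" by (auto simp: \<Gamma>_def)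
  next
    fix z assume "(0, z) \<in> \<Gamma>"
    then obtain A where A: "finite A" "A \<subseteq> Q" "- (\<Sum>q\<in>A. v q) \<in> N" "z = (-1) ^ card A"
      unfolding \<Gamma>_def by auto
    then have "(\<Sum>q\<in>A. v q) \<in> N"
      using neg by fastforce
    then have "A = {}"
      using indep A by blast
    then show "z = 1"
      using A by simp
  qed
  then obtain \<chi> where \<chi>: "\<forall>a. \<chi> a \<noteq> 0" "\<forall>a b. \<chi> (a + b) = \<chi> a * \<chi> b"
    and ext: "\<forall>(a, z)\<in>\<Gamma>. \<chi> a = z"
    using graph_hom_extend by blast
  have "\<chi> a = 1" if "a \<in> N" for a
  proof -
    have "(a, 1) \<in> \<Gamma>"
      unfolding \<Gamma>_def using that by (auto intro!: exI[of _ "{}"])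
    then show ?thesis using ext by auto
  qed
  moreover have "\<chi> (v q) = -1" if "q \<in> Q" for q
  proof -
    have "(v q, -1) \<in> \<Gamma>"
      unfolding \<Gamma>_def using that zero by (auto intro!: exI[of _ "{q}"])
    then show ?thesis using ext by auto
  qed
  ultimately show ?thesis
    using \<chi> by blast
qed

section \<open>Countably many generic characters\<close>

text \<open>The group \<open>K\<close> of the overview: the common kernel of the maps
  \<open>x \<mapsto> cis (2 * pi * x n / 2 ^ n)\<close>.\<close>

definition pow2_multiples :: "(nat \<Rightarrow> int) set" where
  "pow2_multiples = {x. \<forall>n. 2 ^ n dvd x n}"

text \<open>One representative for each class of \<open>pow2_multiples\<close> modulo its doubles,
  hence continuum many classes.\<close>

definition pow2_vec :: "nat set \<Rightarrow> nat \<Rightarrow> int" where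
  "pow2_vec S n = (if n \<in> S then 2 ^ n else 0)"

text \<open>Modulo \<open>2 * pow2_multiples\<close> this is the sum of all \<open>2 ^ n * t n\<close> with \<open>n \<in> S\<close>,
  which converges coordinatewise in the 2-adic topology.\<close>

definition pow2_comb :: "(nat \<Rightarrow> nat \<Rightarrow> int) \<Rightarrow> nat set \<Rightarrow> nat \<Rightarrow> int" where
  "pow2_comb t S m = (\<Sum>n | n \<in> S \<and> n \<le> m. 2 ^ n * t n m)"

text \<open>Codes a demand \<open>(t, i, j)\<close> by a subset of a countable type, which bounds
  the number of demands by the continuum. The leading tag separates the two indices from the graph
  of \<open>t\<close>.\<close>

definition code_set :: "(nat \<Rightarrow> nat \<Rightarrow> int) \<times> nat \<times> nat \<Rightarrow> (nat \<times> nat \<times> nat \<times> int) set" where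
  "code_set = (\<lambda>(t, i, j). insert (0, i, j, 0) (range (\<lambda>(m, n). (1, m, n, t m n))))"

lemma inj_code_set: "inj code_set"
proof (rule injI)
  fix q q' assume eq: "code_set q = code_set q'"
  obtain t i j t' i' j' where q: "q = (t, i, j)" "q' = (t', i', j')"
    by (metis prod_cases3)
  have "(1, m, n, t m n) \<in> code_set q" for m n
    unfolding q code_set_def by force
  then have "t = t'"
    unfolding eq by (intro ext) (auto simp: q code_set_def image_iff)
  moreover have "(0, i, j, 0) \<in> code_set q"
    unfolding q code_set_def by auto
  then have "i = i'" "j = j'"
    unfolding eq by (auto simp: q code_set_def)
  ultimately show "q = q'"
    by (simp add: q)
qed

text \<open>The last conjunct contradicts the equations forced by a homomorphism that preserves
  \<open>- 1\<close>, with \<open>t\<close> listing lifts of the images of the unit vectors. All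
  \<open>\<chi> i\<close> arise at once, from one character on the product of countably many copies
  of the group of integer sequences.\<close>

lemma generic_characters:
  "\<exists>\<chi> :: nat \<Rightarrow> (nat \<Rightarrow> int) \<Rightarrow> complex.
     (\<forall>i x. cmod (\<chi> i x) = 1) \<and> (\<forall>i x y. \<chi> i (x + y) = \<chi> i x * \<chi> i y) \<and>
     (\<forall>i. \<forall>x\<in>pow2_multiples. \<chi> i (x + x) = 1) \<and>
     (\<forall>t i j. i \<noteq> j \<longrightarrow> (\<exists>S. pow2_comb t S \<in> pow2_multiples \<longrightarrow>
        \<chi> i (pow2_comb t S) \<noteq> \<chi> j (pow2_vec S)))"
proof -
  \<comment> \<open>In each component the doubles of \<open>pow2_multiples\<close>, which the
    characters have to kill.\<close>
  define N where "N = {w :: nat \<Rightarrow> nat \<Rightarrow> int. \<forall>i n. 2 ^ (n + 1) dvd w i n}"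
  \<comment> \<open>If some \<open>pow2_comb t S\<close> leaves \<open>pow2_multiples\<close>, that
    \<open>S\<close> meets the demand vacuously; only the other triples need work.\<close>
  define Q where "Q = {(t :: nat \<Rightarrow> nat \<Rightarrow> int, i :: nat, j :: nat).
    i \<noteq> j \<and> (\<forall>S. pow2_comb t S \<in> pow2_multiples)}"
  define emb where "emb i x = (\<lambda>i'. if i' = i then x else 0)" for i :: nat and x :: "nat \<Rightarrow> int"
  \<comment> \<open>The value -1 at \<open>w (t, i, j) S\<close> makes the values at
    \<open>pow2_vec S\<close> in copy \<open>j\<close> and at \<open>pow2_comb t S\<close> in copy
    \<open>i\<close> opposite, hence distinct.\<close>
  define w where "w = (\<lambda>(t, i, j) S. emb j (pow2_vec S) - emb i (pow2_comb t S))"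
  have emb_add: "emb i (x + y) = emb i x + emb i y" for i x y
    by (auto simp: emb_def fun_eq_iff)
  have "\<exists>\<sigma>. \<forall>A. finite A \<longrightarrow> A \<subseteq> Q \<longrightarrow> A \<noteq> {} \<longrightarrow> (\<Sum>q\<in>A. w q (\<sigma> q)) \<notin> N"
  proof (rule independent_transversal)
    have "inj (\<lambda>q. to_nat ` code_set q)"
      using inj_code_set by (simp add: inj_def inj_image_eq_iff)
    then have "inj_on (\<lambda>q. to_nat ` code_set q) Q"
      by (rule inj_on_subset) simp
    then show "|Q| \<le>o |UNIV :: nat set set|"
      using card_of_ordLeq by blast
    show "infinite (UNIV :: nat set set)"
      by (simp add: Finite_Set.finite_set)
    show "a - b \<in> N" if "a \<in> N" "b \<in> N" for a b
      using that by (auto simp: N_def)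
    fix q S S' assume q: "q \<in> Q" and "w q S - w q S' \<in> N"
    then obtain t i j where "i \<noteq> j" "w (t, i, j) S - w (t, i, j) S' \<in> N"
      by (auto simp: Q_def)
    \<comment> \<open>Since \<open>i \<noteq> j\<close>, component \<open>j\<close> shows only the
      \<open>pow2_vec\<close> part, and its entry modulo \<open>2 ^ (n + 1)\<close> tells whether
      \<open>n\<close> is in the set.\<close>
    then have "(2::int) ^ (n + 1) dvd (w (t, i, j) S - w (t, i, j) S') j n" for n
      unfolding N_def by blast
    then have *: "(2::int) ^ (n + 1) dvd pow2_vec S n - pow2_vec S' n" for n
      using \<open>i \<noteq> j\<close> by (auto simp: w_def emb_def)
    have "n \<in> S \<longleftrightarrow> n \<in> S'" for n
      using *[of n] by (auto simp: pow2_vec_def split: if_splits)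
    then show "S = S'" by blast
  qed
  then obtain \<sigma> where \<sigma>: "\<And>A. finite A \<Longrightarrow> A \<subseteq> Q \<Longrightarrow> A \<noteq> {} \<Longrightarrow> (\<Sum>q\<in>A. w q (\<sigma> q)) \<notin> N"
    by blast
  have "\<exists>\<Xi> :: _ \<Rightarrow> complex. (\<forall>a. \<Xi> a \<noteq> 0) \<and> (\<forall>a b. \<Xi> (a + b) = \<Xi> a * \<Xi> b) \<and>
           (\<forall>a\<in>N. \<Xi> a = 1) \<and> (\<forall>q\<in>Q. \<Xi> (w q (\<sigma> q)) = -1)"
  proof (rule sign_character)
    show "0 \<in> N" by (auto simp: N_def)
    show "a - b \<in> N" if "a \<in> N" "b \<in> N" for a b
      using that by (auto simp: N_def)
    show "(\<Sum>q\<in>A. w q (\<sigma> q)) \<notin> N" if "finite A" "A \<subseteq> Q" "A \<noteq> {}" for A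
      using \<sigma> that .
    fix q assume "q \<in> Q"
    then obtain t i j where q: "q = (t, i, j)" "\<And>S. pow2_comb t S \<in> pow2_multiples"
      by (auto simp: Q_def)
    have "2 ^ n dvd w q (\<sigma> q) k n" for k n
      using q by (auto simp: w_def emb_def pow2_vec_def pow2_multiples_def)
    then show "w q (\<sigma> q) + w q (\<sigma> q) \<in> N"
      by (auto simp: N_def mult_2[symmetric])
  qed
  then obtain \<Xi> :: "_ \<Rightarrow> complex" where \<Xi>: "\<And>a. \<Xi> a \<noteq> 0" "\<And>a b. \<Xi> (a + b) = \<Xi> a * \<Xi> b"
    "\<And>a. a \<in> N \<Longrightarrow> \<Xi> a = 1" "\<And>q. q \<in> Q \<Longrightarrow> \<Xi> (w q (\<sigma> q)) = -1"
    by blast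
  \<comment> \<open>\<open>sgn\<close> projects multiplicatively onto the unit circle, fixes 1 and
    keeps opposite values distinct.\<close>
  define \<chi> where "\<chi> i x = sgn (\<Xi> (emb i x))" for i x
  have "\<exists>S. pow2_comb t S \<in> pow2_multiples \<longrightarrow> \<chi> i (pow2_comb t S) \<noteq> \<chi> j (pow2_vec S)"
    if "i \<noteq> j" for t i j
  proof (cases "(t, i, j) \<in> Q")
    case False
    then show ?thesis using that by (auto simp: Q_def)
  next
    case True
    define S where "S = \<sigma> (t, i, j)"
    have "\<Xi> (emb j (pow2_vec S)) = \<Xi> (w (t, i, j) S + emb i (pow2_comb t S))"
      by (simp add: w_def)
    also have "\<dots> = - \<Xi> (emb i (pow2_comb t S))"
      unfolding \<Xi>(2) S_def \<Xi>(4)[OF True] by simp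
    finally have "\<chi> i (pow2_comb t S) \<noteq> \<chi> j (pow2_vec S)"
      using \<Xi>(1) by (auto simp: \<chi>_def sgn_minus sgn_zero_iff)
    then show ?thesis by blast
  qed
  moreover have "\<chi> i (x + x) = 1" if "x \<in> pow2_multiples" for i x
  proof -
    have "emb i (x + x) \<in> N"
      using that by (auto simp: N_def emb_def pow2_multiples_def mult_2[symmetric])
    then show ?thesis
      by (simp add: \<chi>_def \<Xi>(3))
  qed
  ultimately show ?thesis
    using \<Xi>(1,2) by (intro exI[of _ \<chi>]) (auto simp: \<chi>_def emb_add sgn_mult norm_sgn)
qed

section \<open>Copies of a ring inside another type\<close>

text \<open>Transport of structure along an injection, which turns the ring of complex sequences
  into a ring on the universe type.\<close>

definition ring_copy :: "('r::comm_ring_1 \<Rightarrow> 'a) \<Rightarrow> 'a ring" where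
  "ring_copy e = \<lparr>carrier = range e,
     monoid.mult = (\<lambda>a b. e (the_inv e a * the_inv e b)), monoid.one = e 1,
     ring.zero = e 0, ring.add = (\<lambda>a b. e (the_inv e a + the_inv e b))\<rparr>"

definition unit_group :: "'r::comm_ring_1 set \<Rightarrow> bool" where
  "unit_group G \<longleftrightarrow> 1 \<in> G \<and> -1 \<in> G \<and> (\<forall>a\<in>G. \<forall>b\<in>G. a * b \<in> G) \<and> (\<forall>a\<in>G. \<exists>b\<in>G. a * b = 1)"

lemma zero_notin_unit_group: "unit_group G \<Longrightarrow> 0 \<notin> G"
  by (auto simp: unit_group_def)

locale copied_ring =
  fixes e :: "'r::comm_ring_1 \<Rightarrow> 'a"
  assumes inj: "inj e"
begin

lemma copy_simps [simp]:
  "carrier (ring_copy e) = range e"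
  "e a \<otimes>\<^bsub>ring_copy e\<^esub> e b = e (a * b)" "e a \<oplus>\<^bsub>ring_copy e\<^esub> e b = e (a + b)"
  "\<one>\<^bsub>ring_copy e\<^esub> = e 1" "\<zero>\<^bsub>ring_copy e\<^esub> = e 0" "the_inv e (e a) = a" "e a = e b \<longleftrightarrow> a = b"
  using inj by (simp_all add: ring_copy_def the_inv_f_f inj_eq)

lemma cring_copy: "cring (ring_copy e)"
proof (rule cringI)
  show "abelian_group (ring_copy e)"
  proof (rule abelian_groupI)
    fix x assume "x \<in> carrier (ring_copy e)"
    then obtain a where "x = e a" by auto
    then show "\<exists>y\<in>carrier (ring_copy e). y \<oplus>\<^bsub>ring_copy e\<^esub> x = \<zero>\<^bsub>ring_copy e\<^esub>"
      by (intro bexI[of _ "e (- a)"]) auto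
  qed (auto simp: add_ac)
  show "comm_monoid (ring_copy e)"
    by (rule comm_monoidI) (auto simp: mult_ac)
qed (auto simp: distrib_right)

lemma partial_field_copy:
  assumes G: "unit_group G"
  shows "partial_field (ring_copy e, e ` G)"
proof -
  interpret R: cring "ring_copy e" by (rule cring_copy)
  interpret U: group "units_of (ring_copy e)" by (rule R.units_group)
  have unit: "e a \<in> Units (ring_copy e)" if a: "a \<in> G" for a
  proof -
    obtain b where "a * b = 1" "b * a = 1"
      using G a unfolding unit_group_def by (metis mult.commute)
    then show ?thesis
      by (auto simp: Units_def intro!: exI[of _ b])
  qed
  have "\<ominus>\<^bsub>ring_copy e\<^esub> e 1 = e (- 1)"
    by (rule R.minus_equality) auto
  moreover have "subgroup (e ` G) (units_of (ring_copy e))"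
  proof (rule U.subgroupI)
    show "e ` G \<subseteq> carrier (units_of (ring_copy e))"
      using unit by (auto simp: units_of_carrier)
    show "e ` G \<noteq> {}"
      using G by (auto simp: unit_group_def)
    show "x \<otimes>\<^bsub>units_of (ring_copy e)\<^esub> y \<in> e ` G" if "x \<in> e ` G" "y \<in> e ` G" for x y
      using that G by (auto simp: units_of_mult unit_group_def)
    fix x assume "x \<in> e ` G"
    then obtain a b where ab: "x = e a" "a \<in> G" "b \<in> G" "b * a = 1"
      using G unfolding unit_group_def by (metis imageE mult.commute)
    then have "inv\<^bsub>units_of (ring_copy e)\<^esub> x = e b"
      using unit by (intro U.inv_equality) (auto simp: units_of_carrier units_of_mult units_of_one)
    then show "inv\<^bsub>units_of (ring_copy e)\<^esub> x \<in> e ` G"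
      using ab by simp
  qed
  ultimately show ?thesis
    using G cring_copy by (auto simp: partial_field_def unit_group_def)
qed

lemma copy_in_pf_over:
  assumes F: "field F" and G: "unit_group G"
    and h: "h 0 = \<zero>\<^bsub>F\<^esub>" "h 1 = \<one>\<^bsub>F\<^esub>" "\<And>a. a \<in> G \<Longrightarrow> h a \<in> Units F"
      "\<And>a b. a \<in> G \<Longrightarrow> b \<in> G \<Longrightarrow> h (a * b) = h a \<otimes>\<^bsub>F\<^esub> h b"
      "\<And>a b. a \<in> insert 0 G \<Longrightarrow> b \<in> insert 0 G \<Longrightarrow> a + b \<in> insert 0 G \<Longrightarrow> h (a + b) = h a \<oplus>\<^bsub>F\<^esub> h b"
  shows "(ring_copy e, e ` G) \<in> pf_over F"
proof -
  interpret F: field F by fact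
  have mult: "h (a * b) = h a \<otimes>\<^bsub>F\<^esub> h b" if "a \<in> insert 0 G" "b \<in> insert 0 G" for a b
    using that h(1,4) F.Units_closed[OF h(3)] by auto
  have "pf_hom (ring_copy e, e ` G) (pf_of_field F) (\<lambda>x. h (the_inv e x))"
    unfolding pf_hom_def
  proof (intro conjI ballI impI)
    let ?P = "pf_elems (ring_copy e, e ` G)"
    have P: "?P = e ` insert 0 G"
      by (simp add: pf_elems_def)
    show "(\<lambda>x. h (the_inv e x)) \<in> ?P \<rightarrow> pf_elems (pf_of_field F)"
      using h by (auto simp: pf_elems_def pf_of_field_def)
    show "h (the_inv e \<one>\<^bsub>fst (ring_copy e, e ` G)\<^esub>) = \<one>\<^bsub>fst (pf_of_field F)\<^esub>"
      using h by (simp add: pf_of_field_def)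
    fix p q assume "p \<in> ?P" "q \<in> ?P"
    then obtain a b where ab: "p = e a" "q = e b" "a \<in> insert 0 G" "b \<in> insert 0 G"
      unfolding P by blast
    then show "h (the_inv e (p \<otimes>\<^bsub>fst (ring_copy e, e ` G)\<^esub> q)) =
        h (the_inv e p) \<otimes>\<^bsub>fst (pf_of_field F)\<^esub> h (the_inv e q)"
      using mult by (simp add: pf_of_field_def)
    fix r assume "r \<in> ?P" "p \<oplus>\<^bsub>fst (ring_copy e, e ` G)\<^esub> q = r"
    then have "a + b \<in> insert 0 G" "r = e (a + b)"
      unfolding P ab by auto
    then show "h (the_inv e p) \<oplus>\<^bsub>fst (pf_of_field F)\<^esub> h (the_inv e q) = h (the_inv e r)"
      using h(5)[OF ab(3,4)] ab by (simp add: pf_of_field_def)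
  qed
  then show ?thesis
    using partial_field_copy[OF G] unfolding pf_over_def by blast
qed

text \<open>The relations \<open>0 + 0 = 0\<close> and \<open>1 + (- 1) = 0\<close> hold among
  elements, so they force \<open>f 0 = 0\<close> and \<open>f (- 1) = - 1\<close>. Inverses map to
  inverses, so no element of \<open>G1\<close> is sent to 0.\<close>

lemma hom_ge_copyE:
  assumes "(ring_copy e, e ` G2) \<succeq>\<^sub>H\<^sub>o\<^sub>m (ring_copy e, e ` G1)"
    and G1: "unit_group G1" and G2: "unit_group G2"
  obtains f where "\<And>a. a \<in> G1 \<Longrightarrow> f a \<in> G2" "f 1 = 1" "f (- 1) = - 1"
    "\<And>a b. a \<in> G1 \<Longrightarrow> b \<in> G1 \<Longrightarrow> f (a * b) = f a * f b"
    "\<And>a b. a \<in> G1 \<Longrightarrow> b \<in> G1 \<Longrightarrow> a + b \<in> G1 \<Longrightarrow> f (a + b) = f a + f b"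
proof -
  obtain \<phi> where \<phi>: "pf_hom (ring_copy e, e ` G1) (ring_copy e, e ` G2) \<phi>"
    using assms(1) unfolding hom_ge_def by blast
  define f where "f a = the_inv e (\<phi> (e a))" for a
  have elems: "pf_elems (ring_copy e, e ` G) = e ` insert 0 G" for G
    by (simp add: pf_elems_def)
  have \<phi>_elem: "\<phi> (e a) \<in> e ` insert 0 G2" if "a \<in> insert 0 G1" for a
    using \<phi> that unfolding pf_hom_def elems by blast
  have \<phi>_e: "\<phi> (e a) = e (f a)" and f_elem: "f a \<in> insert 0 G2" if "a \<in> insert 0 G1" for a
    using \<phi>_elem[OF that] by (auto simp: f_def)
  have f_one: "f 1 = 1"
    using \<phi> by (simp add: pf_hom_def f_def)
  have f_mult: "f (a * b) = f a * f b" if "a \<in> insert 0 G1" "b \<in> insert 0 G1" for a b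
  proof -
    have "\<phi> (e a \<otimes>\<^bsub>ring_copy e\<^esub> e b) = \<phi> (e a) \<otimes>\<^bsub>ring_copy e\<^esub> \<phi> (e b)"
      using \<phi> that unfolding pf_hom_def elems by auto
    then show ?thesis
      using that by (simp add: \<phi>_e) (simp add: f_def)
  qed
  have f_add: "f (a + b) = f a + f b"
    if "a \<in> insert 0 G1" "b \<in> insert 0 G1" "a + b \<in> insert 0 G1" for a b
  proof -
    have "\<forall>p\<in>e ` insert 0 G1. \<forall>q\<in>e ` insert 0 G1. \<forall>r\<in>e ` insert 0 G1.
        p \<oplus>\<^bsub>ring_copy e\<^esub> q = r \<longrightarrow> \<phi> p \<oplus>\<^bsub>ring_copy e\<^esub> \<phi> q = \<phi> r"
      using \<phi> unfolding pf_hom_def elems by simp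
    then have "\<phi> (e a) \<oplus>\<^bsub>ring_copy e\<^esub> \<phi> (e b) = \<phi> (e (a + b))"
      using that copy_simps(3) by (metis image_eqI)
    then show ?thesis
      using that by (simp add: \<phi>_e)
  qed
  have f_zero: "f 0 = 0"
    using f_add[of 0 0] by simp
  have "f 1 + f (- 1) = f 0"
    using f_add[of 1 "- 1"] G1 by (simp add: unit_group_def)
  then have f_neg: "f (- 1) = - 1"
    unfolding f_one f_zero by (simp add: add_eq_0_iff)
  have "f a \<in> G2" if a: "a \<in> G1" for a
  proof -
    obtain b where "b \<in> G1" "a * b = 1"
      using G1 a by (auto simp: unit_group_def)
    then have "f a * f b = 1"
      using f_mult[of a b] a f_one by simp
    then show ?thesis
      using f_elem[of a] a by auto
  qed
  then show ?thesis
    using that[of f] f_one f_neg f_mult f_add by simp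
qed

end

text \<open>A real number is determined by the rationals below it; the middle component 0 or 1
  separates real from imaginary parts.\<close>

lemma inj_nat_complex_code:
  "inj (\<lambda>f :: nat \<Rightarrow> complex. to_nat ` ({(n, 0::nat, q::rat) | n q. of_rat q < Re (f n)} \<union>
     {(n, 1, q) | n q. of_rat q < Im (f n)}))" (is "inj (\<lambda>f. to_nat ` ?c f)")
proof (rule injI)
  fix f g :: "nat \<Rightarrow> complex"
  have real_eq: "x = y" if "\<And>q. of_rat q < x \<longleftrightarrow> of_rat q < y" for x y :: real
  proof (rule ccontr)
    assume "x \<noteq> y"
    then have "\<exists>q. (x < of_rat q \<and> of_rat q < y) \<or> (y < of_rat q \<and> of_rat q < x)"
      using of_rat_dense[of x y] of_rat_dense[of y x] by (cases "x < y") auto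
    then show False
      using that by (meson less_asym)
  qed
  assume "to_nat ` ?c f = to_nat ` ?c g"
  then have "?c f = ?c g"
    by (simp only: inj_image_eq_iff[OF inj_to_nat])
  then have "(n, k, q) \<in> ?c f \<longleftrightarrow> (n, k, q) \<in> ?c g" for n k q
    by (rule arg_cong)
  from this[of _ 0] this[of _ 1] have "of_rat q < Re (f n) \<longleftrightarrow> of_rat q < Re (g n)"
    "of_rat q < Im (f n) \<longleftrightarrow> of_rat q < Im (g n)" for n q
    by auto
  then show "f = g"
    by (intro ext complex_eqI real_eq) auto
qed

section \<open>Fields of characteristic two\<close>

lemma power_fun_apply [simp]: "(f ^ k) x = f x ^ k"
  for f :: "'i \<Rightarrow> 'c::monoid_mult"
  by (induction k) simp_all

lemma cis_root_eq_one_iff: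
  assumes "m > 0"
  shows "cis (2 * pi * of_int k / of_nat m) = 1 \<longleftrightarrow> int m dvd k"
proof
  assume "int m dvd k"
  then obtain l where "k = int m * l" ..
  then have "2 * pi * of_int k / of_nat m = 2 * pi * of_int l"
    using assms by simp
  then show "cis (2 * pi * of_int k / of_nat m) = 1"
    by (metis Ints_of_int cis_multiple_2pi)
next
  assume "cis (2 * pi * of_int k / of_nat m) = 1"
  then have "cos (2 * pi * of_int k / of_nat m) = 1"
    by (metis cis.sel(1) one_complex.sel(1))
  then obtain l :: int where "2 * pi * of_int k / of_nat m = of_int l * 2 * pi"
    using cos_one_2pi_int by auto
  then have "of_int k = (of_int (l * int m) :: real)"
    using assms by (simp add: field_simps)
  then have "k = l * int m"
    using of_int_eq_iff by blast
  then show "int m dvd k"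
    by simp
qed

lemma cis_dyadic_eq_one_iff: "cis (2 * pi * of_int k / 2 ^ n) = 1 \<longleftrightarrow> (2 :: int) ^ n dvd k"
  using cis_root_eq_one_iff[of "2 ^ n" k] by simp

text \<open>Both moduli being 1 forces \<open>Re u = 1 / 2\<close>, so \<open>u\<close> is a
  primitive sixth root of unity.\<close>

lemma unit_circle_sum_eq_one:
  fixes u v :: complex
  assumes "cmod u = 1" "cmod v = 1" "u + v = 1"
  shows "u\<^sup>2 - u + 1 = 0"
proof -
  have v: "v = 1 - u"
    using assms(3) by (simp add: algebra_simps)
  have "(Re u)\<^sup>2 + (Im u)\<^sup>2 = 1" "(1 - Re u)\<^sup>2 + (Im u)\<^sup>2 = 1"
    using assms(1,2) unfolding v by (simp_all add: cmod_def)
  moreover from this have "Re u = 1 / 2"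
    by (auto simp: power2_eq_square algebra_simps)
  ultimately have *: "Re u = 1 / 2" "Im u * Im u = 3 / 4"
    by (auto simp: power2_eq_square)
  show ?thesis
    unfolding complex_eq_iff power2_eq_square by (simp only: complex.sel minus_complex.simps
      plus_complex.simps times_complex.simps one_complex.simps zero_complex.simps *) simp
qed

section \<open>The group attached to one character\<close>

locale dyadic_character =
  fixes \<chi> :: "(nat \<Rightarrow> int) \<Rightarrow> complex"
  assumes norm_char: "cmod (\<chi> x) = 1"
    and char_add: "\<chi> (x + y) = \<chi> x * \<chi> y"
    and char_double: "x \<in> pow2_multiples \<Longrightarrow> \<chi> (x + x) = 1"
begin

text \<open>Coordinate 0 is \<open>\<chi> x\<close>, and the sequence is constant exactly for
  \<open>x \<in> pow2_multiples\<close>. The kernel is therefore that of \<open>\<chi>\<close> on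
  \<open>pow2_multiples\<close>, and \<open>range \<theta>\<close> is the quotient of the
  overview.\<close>

definition \<theta> :: "(nat \<Rightarrow> int) \<Rightarrow> nat \<Rightarrow> complex" where
  "\<theta> x n = \<chi> x * cis (2 * pi * of_int (x n) / 2 ^ n)"

lemma char_nonzero: "\<chi> x \<noteq> 0"
  using norm_char[of x] by auto

lemma char_zero: "\<chi> 0 = 1"
  using char_add[of 0 0] char_nonzero[of 0] by simp

lemma norm_theta: "cmod (\<theta> x n) = 1"
  by (simp add: \<theta>_def norm_mult norm_char)

lemma theta_add: "\<theta> (x + y) = \<theta> x * \<theta> y"
  by (simp add: fun_eq_iff \<theta>_def char_add cis_mult[symmetric] add_divide_distrib distrib_left mult_ac)

lemma theta_zero: "\<theta> 0 = 1"
  by (simp add: fun_eq_iff \<theta>_def char_zero)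

lemma theta_minus: "\<theta> x * \<theta> (- x) = 1"
  using theta_add[of x "- x"] theta_zero by simp

lemma theta_of_nat: "\<theta> (of_nat k * x) = \<theta> x ^ k"
  by (induction k) (simp_all only: of_nat_0 of_nat_Suc mult_zero_left power_0 power_Suc distrib_right
      mult_1_left theta_zero theta_add)

lemma theta_pow2_multiples: "x \<in> pow2_multiples \<Longrightarrow> \<theta> x = (\<lambda>_. \<chi> x)"
  by (simp add: fun_eq_iff \<theta>_def cis_dyadic_eq_one_iff pow2_multiples_def)

lemma theta_at_0: "\<theta> x 0 = \<chi> x"
  using cis_dyadic_eq_one_iff[of "x 0" 0] by (simp add: \<theta>_def)

lemma theta_constD:
  assumes "\<theta> x = (\<lambda>_. c)"
  shows "x \<in> pow2_multiples" "\<chi> x = c"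
proof -
  show "\<chi> x = c"
    using theta_at_0[of x] assms by simp
  moreover have "\<theta> x n = c" for n
    using assms by simp
  ultimately have "cis (2 * pi * of_int (x n) / 2 ^ n) = 1" for n
    using char_nonzero[of x] by (simp add: \<theta>_def)
  then show "x \<in> pow2_multiples"
    by (simp add: cis_dyadic_eq_one_iff pow2_multiples_def)
qed

lemma theta_eqD: "\<theta> x = \<theta> y \<Longrightarrow> x - y \<in> pow2_multiples"
  using theta_add[of x "- y"] theta_minus[of y] theta_constD(1)[of "x - y" 1]
  by (simp add: one_fun_def)

lemma char_pm1:
  assumes "x \<in> pow2_multiples"
  shows "\<chi> x = 1 \<or> \<chi> x = - 1"
proof -
  have "(\<chi> x)\<^sup>2 = 1"
    using char_double[OF assms] unfolding char_add power2_eq_square .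
  then show ?thesis
    by (simp add: power2_eq_1_iff)
qed

lemma theta_double:
  assumes "x \<in> pow2_multiples"
  shows "\<theta> (x + x) = 1"
  using char_pm1[OF assms] unfolding theta_add theta_pow2_multiples[OF assms]
  by (auto simp: fun_eq_iff)

text \<open>Otherwise every coordinate of \<open>\<theta> x\<close> is a primitive sixth root of
  unity, so its cube is -1 and \<open>3 * x\<close> lies in \<open>pow2_multiples\<close>. As 3 is
  odd, so does \<open>x\<close>; but then coordinate 0 is 1 or -1, no root of the quadratic.\<close>

lemma theta_sum_neq_one: "\<theta> x + \<theta> y \<noteq> 1"
proof
  assume sum: "\<theta> x + \<theta> y = 1"
  have quad: "(\<theta> x n)\<^sup>2 - \<theta> x n + 1 = 0" for n
    using norm_theta norm_theta fun_cong[OF sum, of n]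
    by (intro unit_circle_sum_eq_one[where v = "\<theta> y n"]) auto
  have "\<theta> (of_nat 3 * x) n = - 1" for n
  proof -
    have "(\<theta> x n) ^ 3 + 1 = (\<theta> x n + 1) * ((\<theta> x n)\<^sup>2 - \<theta> x n + 1)"
      by (simp add: algebra_simps power2_eq_square power3_eq_cube)
    then show ?thesis
      unfolding quad theta_of_nat by (simp add: power3_eq_cube eq_neg_iff_add_eq_0)
  qed
  then have "of_nat 3 * x \<in> pow2_multiples"
    by (intro theta_constD(1)[where c = "- 1"]) auto
  then have "(2::int) ^ n dvd 3 * x n" for n
    by (simp add: pow2_multiples_def)
  then have "(2::int) ^ n dvd x n" for n
    by (metis coprime_dvd_mult_right_iff coprime_power_left_iff gcd_1_int coprime_iff_gcd_eq_1
        dvd_refl even_numeral odd_numeral coprime_left_2_iff_odd)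
  then have "x \<in> pow2_multiples"
    by (simp add: pow2_multiples_def)
  then show False
    using char_pm1[of x] quad[of 0] by (auto simp: theta_at_0)
qed

lemma theta_sum_notin_range: "\<theta> x + \<theta> y \<notin> range \<theta>"
proof
  assume "\<theta> x + \<theta> y \<in> range \<theta>"
  then obtain z where "\<theta> x + \<theta> y = \<theta> z" by auto
  then have "\<theta> (x - z) + \<theta> (y - z) = 1"
    using theta_add[of _ "- z"] theta_minus[of z] by (simp flip: distrib_right)
  then show False
    using theta_sum_neq_one by blast
qed

lemma unit_group_range_theta:
  assumes "k \<in> pow2_multiples" "\<chi> k = - 1"
  shows "unit_group (range \<theta>)"
proof -
  have "\<theta> k = - 1"
    unfolding theta_pow2_multiples[OF assms(1)] assms(2) by (simp add: fun_eq_iff)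
  then have "- 1 \<in> range \<theta>"
    by (metis rangeI)
  moreover have "1 \<in> range \<theta>"
    using theta_zero by (metis rangeI)
  moreover have "\<exists>b\<in>range \<theta>. \<theta> x * b = 1" for x
    using theta_minus by blast
  ultimately show ?thesis
    using theta_add[symmetric] by (auto simp: unit_group_def)
qed

end

section \<open>Homomorphisms between two such groups\<close>

lemma pow2_vec_in: "pow2_vec S \<in> pow2_multiples"
  by (auto simp: pow2_vec_def pow2_multiples_def)

text \<open>An infinite sum is not seen by an abstract homomorphism, but its tail beyond position
  \<open>m\<close> is a multiple of \<open>2 ^ m\<close>, so coordinate \<open>m\<close> of the image is still determined modulo
  \<open>2 ^ m\<close>. Halving the sum first makes this precise enough, since twice an element of
  \<open>pow2_multiples\<close> is killed by the character.\<close>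

lemma pointed_hom_pow2_vec:
  assumes \<chi>1: "dyadic_character \<chi>1" and \<chi>2: "dyadic_character \<chi>2"
    and img: "\<And>x. f (dyadic_character.\<theta> \<chi>1 x) = dyadic_character.\<theta> \<chi>2 (g x)"
    and one: "f 1 = 1" and neg: "f (- 1) = - 1"
    and mult: "\<And>x y. f (dyadic_character.\<theta> \<chi>1 x * dyadic_character.\<theta> \<chi>1 y) =
      f (dyadic_character.\<theta> \<chi>1 x) * f (dyadic_character.\<theta> \<chi>1 y)"
  defines "t \<equiv> \<lambda>n. g (\<lambda>m. if m = n then 1 else 0)"
  shows "pow2_comb t S \<in> pow2_multiples \<and> \<chi>2 (pow2_comb t S) = \<chi>1 (pow2_vec S)"
proof -
  interpret A: dyadic_character \<chi>1 by fact
  interpret B: dyadic_character \<chi>2 by fact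
  define T where "T x = f (A.\<theta> x)" for x
  define unit :: "nat \<Rightarrow> nat \<Rightarrow> int" where "unit n = (\<lambda>m. if m = n then 1 else 0)" for n
  have T_g: "T x = B.\<theta> (g x)" for x
    by (simp add: T_def img)
  have T_unit: "T (unit n) = B.\<theta> (t n)" for n
    by (simp add: T_g t_def unit_def)
  have T_add: "T (x + y) = T x * T y" for x y
    by (simp add: T_def A.theta_add mult)
  have T_zero: "T 0 = 1"
    by (simp add: T_def A.theta_zero one)
  have T_of_nat: "T (of_nat k * x) = T x ^ k" for k x
    by (induction k) (simp_all only: of_nat_0 of_nat_Suc mult_zero_left power_0 power_Suc distrib_right
        mult_1_left T_zero T_add)
  have T_sum: "T (\<Sum>n\<in>J. of_nat (c n) * unit n) = B.\<theta> (\<Sum>n\<in>J. of_nat (c n) * t n)"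
    if "finite J" for J c
    using that
    by (induction J rule: finite_induct)
      (simp_all only: sum.empty sum.insert not_False_eq_True T_zero B.theta_zero T_add B.theta_add
        T_of_nat B.theta_of_nat T_unit)
  \<comment> \<open>\<open>r\<close> is half of \<open>pow2_vec S\<close> and \<open>u\<close> half
    of \<open>pow2_comb t S\<close>, both without the term for 0, whose coefficient
    \<open>2 ^ 0\<close> cannot be halved.\<close>
  define r :: "nat \<Rightarrow> int" where "r n = (if n \<in> S \<and> n \<ge> 1 then 2 ^ (n - 1) else 0)" for n
  define u :: "nat \<Rightarrow> int" where "u m = (\<Sum>n | n \<in> S \<and> 1 \<le> n \<and> n \<le> m. 2 ^ (n - 1) * t n m)" for m
  have "g r - u \<in> pow2_multiples"
    unfolding pow2_multiples_def
  proof (intro CollectI allI)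
    fix m
    define J where "J = {n. n \<in> S \<and> 1 \<le> n \<and> n \<le> m}"
    have J: "finite J"
      by (rule finite_subset[of _ "{..m}"]) (auto simp: J_def)
    \<comment> \<open>The tail of \<open>r\<close> beyond \<open>m\<close> divided by
      \<open>2 ^ m\<close>; for \<open>n > m\<close> the exponent \<open>n - 1\<close> is still at
      least \<open>m\<close>. The rest is a finite combination of unit vectors, on which
      \<open>T\<close> is known.\<close>
    define r' :: "nat \<Rightarrow> int" where "r' n = (if n \<in> S \<and> n > m then 2 ^ (n - 1 - m) else 0)" for n
    have sum_apply: "(\<Sum>n\<in>J. F n) k = (\<Sum>n\<in>J. F n k)" for F :: "nat \<Rightarrow> nat \<Rightarrow> int" and k
      by (induction J rule: infinite_finite_induct) auto
    have u_J: "u m = (\<Sum>n\<in>J. 2 ^ (n - 1) * t n m)"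
      by (simp add: u_def J_def)
    have r_split: "r = (\<Sum>n\<in>J. of_nat (2 ^ (n - 1)) * unit n) + of_nat (2 ^ m) * r'"
    proof
      fix k
      have "(\<Sum>n\<in>J. of_nat (2 ^ (n - 1)) * unit n) k = (\<Sum>n\<in>J. if k = n then 2 ^ (n - 1) else 0)"
        unfolding sum_apply by (intro sum.cong) (auto simp: unit_def)
      also have "\<dots> = (if k \<in> J then 2 ^ (k - 1) else 0)"
        using J by simp
      finally have sum_k:
        "(\<Sum>n\<in>J. of_nat (2 ^ (n - 1)) * unit n) k = (if k \<in> J then 2 ^ (k - 1) else 0)" .
      have "(2::int) ^ m * 2 ^ (k - 1 - m) = 2 ^ (k - 1)" if "k > m"
        using that by (simp only: flip: power_add) simp
      then have "r k = (if k \<in> J then 2 ^ (k - 1) else 0) + 2 ^ m * r' k"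
        by (cases "k \<le> m") (auto simp: r_def r'_def J_def not_le)
      then show "r k = ((\<Sum>n\<in>J. of_nat (2 ^ (n - 1)) * unit n) + of_nat (2 ^ m) * r') k"
        unfolding plus_fun_apply sum_k by simp
    qed
    have "B.\<theta> (g r) = T r"
      by (simp only: T_g)
    also have "\<dots> = T ((\<Sum>n\<in>J. of_nat (2 ^ (n - 1)) * unit n) + of_nat (2 ^ m) * r')"
      using r_split by (rule arg_cong)
    also have "\<dots> = B.\<theta> ((\<Sum>n\<in>J. of_nat (2 ^ (n - 1)) * t n) + of_nat (2 ^ m) * g r')"
      unfolding T_add T_sum[OF J] T_of_nat B.theta_add B.theta_of_nat by (simp only: T_g)
    finally have "B.\<theta> (g r) = B.\<theta> ((\<Sum>n\<in>J. of_nat (2 ^ (n - 1)) * t n) + of_nat (2 ^ m) * g r')" .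
    \<comment> \<open>\<open>g\<close> is an arbitrary choice of lifts, so equal values of
      \<open>\<theta>\<close> give equality only modulo \<open>pow2_multiples\<close>.\<close>
    then have "2 ^ m dvd (g r - ((\<Sum>n\<in>J. of_nat (2 ^ (n - 1)) * t n) + of_nat (2 ^ m) * g r')) m"
      using B.theta_eqD unfolding pow2_multiples_def by blast
    then have "2 ^ m dvd g r m - u m - 2 ^ m * g r' m"
      by (simp add: sum_apply u_J diff_diff_eq)
    then have "2 ^ m dvd (g r m - u m - 2 ^ m * g r' m) + 2 ^ m * g r' m"
      by (rule dvd_add) simp
    then show "2 ^ m dvd (g r - u) m"
      by simp
  qed
  \<comment> \<open>Doubling \<open>r\<close> to recover \<open>pow2_vec S\<close> also doubles the
    error \<open>g r - u\<close>, which \<open>\<theta>\<close> then kills.\<close>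
  then have tail: "B.\<theta> ((g r - u) + (g r - u)) = 1"
    by (rule B.theta_double)
  define c :: nat where "c = (if 0 \<in> S then 1 else 0)"
  have vec: "pow2_vec S = of_nat c * unit 0 + (r + r)"
  proof
    fix n
    show "pow2_vec S n = (of_nat c * unit 0 + (r + r)) n"
      by (cases n) (auto simp: pow2_vec_def r_def c_def unit_def)
  qed
  have "T (pow2_vec S) = B.\<theta> (of_nat c * t 0 + (g r + g r))"
    unfolding vec T_add B.theta_add T_of_nat B.theta_of_nat T_unit by (simp only: T_g)
  also have "of_nat c * t 0 + (g r + g r) = (of_nat c * t 0 + (u + u)) + ((g r - u) + (g r - u))"
    by (simp add: algebra_simps)
  also have "B.\<theta> \<dots> = B.\<theta> (of_nat c * t 0 + (u + u))"
    by (subst B.theta_add) (simp only: tail mult_1_right)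
  also have "of_nat c * t 0 + (u + u) = pow2_comb t S"
  proof
    fix m
    define J where "J = {n. n \<in> S \<and> 1 \<le> n \<and> n \<le> m}"
    have J: "finite J" "0 \<notin> J"
      by (rule finite_subset[of _ "{..m}"]) (auto simp: J_def)
    have "{n. n \<in> S \<and> n \<le> m} = (if 0 \<in> S then insert 0 J else J)"
      by (auto simp: J_def Suc_le_eq intro: gr0I)
    then have "pow2_comb t S m = of_nat c * t 0 m + (\<Sum>n\<in>J. 2 ^ n * t n m)"
      using J by (auto simp: pow2_comb_def c_def)
    also have "(\<Sum>n\<in>J. 2 ^ n * t n m) = (\<Sum>n\<in>J. 2 ^ (n - 1) * t n m + 2 ^ (n - 1) * t n m)"
      by (intro sum.cong refl) (auto simp: J_def power_eq_if)
    also have "\<dots> = u m + u m"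
      unfolding sum.distrib u_def J_def ..
    finally show "(of_nat c * t 0 + (u + u)) m = pow2_comb t S m"
      by simp
  qed
  finally have "B.\<theta> (pow2_comb t S) = T (pow2_vec S)" ..
  \<comment> \<open>On \<open>pow2_multiples\<close> the sequence is constantly 1 or -1, where
    \<open>f\<close> is prescribed; constancy of the image gives both conclusions.\<close>
  also have "\<dots> = (\<lambda>_. \<chi>1 (pow2_vec S))"
    unfolding T_def A.theta_pow2_multiples[OF pow2_vec_in]
    using A.char_pm1[OF pow2_vec_in, of S] one neg
    by (auto simp: one_fun_def fun_Compl_def)
  finally show ?thesis
    using B.theta_constD by blast
qed

text \<open>Sending every unit to 1 respects addition: no two units sum to a unit, and opposite
  units are harmless because \<open>1 + 1 = 0\<close> in the field. So membership is automatic, and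
  the generic characters exclude all relations.\<close>

lemma not_wqo_char_2:
  fixes F :: "'b ring" and e :: "(nat \<Rightarrow> complex) \<Rightarrow> 'a"
  assumes F: "field F" and two: "\<one>\<^bsub>F\<^esub> \<oplus>\<^bsub>F\<^esub> \<one>\<^bsub>F\<^esub> = \<zero>\<^bsub>F\<^esub>" and e: "inj e"
  shows "\<not> wqo_on (pf_over F :: 'a partial_field set) (\<succeq>\<^sub>H\<^sub>o\<^sub>m)"
proof -
  interpret F: field F by fact
  interpret copied_ring e by standard fact
  obtain \<chi> :: "nat \<Rightarrow> (nat \<Rightarrow> int) \<Rightarrow> complex" where \<chi>: "\<And>i x. cmod (\<chi> i x) = 1"
    "\<And>i x y. \<chi> i (x + y) = \<chi> i x * \<chi> i y" "\<And>i x. x \<in> pow2_multiples \<Longrightarrow> \<chi> i (x + x) = 1"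
    and gen: "\<And>t i j. i \<noteq> j \<Longrightarrow> \<exists>S. pow2_comb t S \<in> pow2_multiples \<longrightarrow>
        \<chi> i (pow2_comb t S) \<noteq> \<chi> j (pow2_vec S)"
    using generic_characters by metis
  have dc: "dyadic_character (\<chi> i)" for i
    by standard (use \<chi> in auto)
  define G where "G i = range (dyadic_character.\<theta> (\<chi> i))" for i
  have G: "unit_group (G i)" for i
  proof -
    interpret dyadic_character "\<chi> i" by (rule dc)
    have zero: "pow2_comb (\<lambda>_ _. 0) S = 0" for S
      by (auto simp: pow2_comb_def)
    have "0 \<in> pow2_multiples"
      by (simp add: pow2_multiples_def)
    \<comment> \<open>The table \<open>t = 0\<close> makes every \<open>pow2_comb\<close> vanish, so
      some \<open>pow2_vec S\<close> has a value other than 1, necessarily -1; it supplies the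
      element -1 of the group.\<close>
    then obtain S where "\<chi> i (pow2_vec S) \<noteq> \<chi> (Suc i) 0"
      using gen[of "Suc i" i "\<lambda>_ _. 0"] unfolding zero by (metis n_not_Suc_n)
    then have "\<chi> i (pow2_vec S) = - 1"
      using char_pm1[OF pow2_vec_in] dyadic_character.char_zero[OF dc] by metis
    then show ?thesis
      unfolding G_def using unit_group_range_theta pow2_vec_in by blast
  qed
  define a where "a i = (ring_copy e, e ` G i)" for i
  have "a i \<in> pf_over F" for i
    unfolding a_def
  proof (rule copy_in_pf_over[OF F G, where h = "\<lambda>x. if x = 0 then \<zero>\<^bsub>F\<^esub> else \<one>\<^bsub>F\<^esub>"])
    interpret dyadic_character "\<chi> i" by (rule dc)
    have nz: "x \<noteq> 0" if "x \<in> G i" for x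
      using that zero_notin_unit_group[OF G] by blast
    show "(if x = 0 then \<zero>\<^bsub>F\<^esub> else \<one>\<^bsub>F\<^esub>) \<in> Units F" if "x \<in> G i" for x
      using nz[OF that] by simp
    show "(if x * y = 0 then \<zero>\<^bsub>F\<^esub> else \<one>\<^bsub>F\<^esub>) =
        (if x = 0 then \<zero>\<^bsub>F\<^esub> else \<one>\<^bsub>F\<^esub>) \<otimes>\<^bsub>F\<^esub> (if y = 0 then \<zero>\<^bsub>F\<^esub> else \<one>\<^bsub>F\<^esub>)"
      if "x \<in> G i" "y \<in> G i" for x y
    proof -
      have "x * y \<in> G i"
        using G that by (simp add: unit_group_def)
      then show ?thesis
        using nz that by simp
    qed
    fix x y assume "x \<in> insert 0 (G i)" "y \<in> insert 0 (G i)" "x + y \<in> insert 0 (G i)"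
    then have "x = 0 \<or> y = 0 \<or> (x \<in> G i \<and> y \<in> G i \<and> x + y = 0)"
      using theta_sum_notin_range unfolding G_def by auto
    then show "(if x + y = 0 then \<zero>\<^bsub>F\<^esub> else \<one>\<^bsub>F\<^esub>) =
        (if x = 0 then \<zero>\<^bsub>F\<^esub> else \<one>\<^bsub>F\<^esub>) \<oplus>\<^bsub>F\<^esub> (if y = 0 then \<zero>\<^bsub>F\<^esub> else \<one>\<^bsub>F\<^esub>)"
      using nz two by auto
  qed auto
  moreover have "\<not> a i \<succeq>\<^sub>H\<^sub>o\<^sub>m a j" if "j < i" for i j
  proof
    assume "a i \<succeq>\<^sub>H\<^sub>o\<^sub>m a j"
    then obtain f where f: "\<And>x. x \<in> G j \<Longrightarrow> f x \<in> G i" "f 1 = 1" "f (- 1) = - 1"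
      "\<And>x y. x \<in> G j \<Longrightarrow> y \<in> G j \<Longrightarrow> f (x * y) = f x * f y"
      unfolding a_def by (rule hom_ge_copyE[OF _ G G]) blast
    have "\<exists>y. f (dyadic_character.\<theta> (\<chi> j) x) = dyadic_character.\<theta> (\<chi> i) y" for x
      using f(1) unfolding G_def by blast
    \<comment> \<open>A lift of \<open>f\<close> to integer sequences, not necessarily
      additive.\<close>
    then obtain g where "\<And>x. f (dyadic_character.\<theta> (\<chi> j) x) = dyadic_character.\<theta> (\<chi> i) (g x)"
      by metis
    then have "pow2_comb (\<lambda>n. g (\<lambda>m. if m = n then 1 else 0)) S \<in> pow2_multiples \<and>
        \<chi> i (pow2_comb (\<lambda>n. g (\<lambda>m. if m = n then 1 else 0)) S) = \<chi> j (pow2_vec S)" for S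
      using f(2-4) by (intro pointed_hom_pow2_vec[OF dc dc, of f]) (auto simp: G_def)
    then show False
      using gen[of i j] that by (metis less_irrefl)
  qed
  ultimately have "range a \<subseteq> pf_over F" "\<not> (\<exists>i j. j < i \<and> a i \<succeq>\<^sub>H\<^sub>o\<^sub>m a j)"
    by auto
  then show ?thesis
    unfolding wqo_on_def by blast
qed

section \<open>Fields of other characteristic\<close>

text \<open>\<open>D\<close> is the ring of integers with 2 inverted; it maps to every field in
  which 2 is invertible. The groups below have their coordinate 0 in \<open>D\<close>.\<close>

lemma dyadic_rationals_to_field:
  fixes F (structure)
  assumes "field F" and two: "\<one> \<oplus> \<one> \<noteq> \<zero>"
  defines "D \<equiv> {complex_of_int n / 2 ^ k | n k. True}"
  shows "\<exists>\<rho>. \<rho> 0 = \<zero> \<and> \<rho> 1 = \<one> \<and> (\<forall>z\<in>D. \<rho> z \<in> carrier F) \<and>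
    (\<forall>z\<in>D. \<forall>w\<in>D. \<rho> (z + w) = \<rho> z \<oplus> \<rho> w \<and> \<rho> (z * w) = \<rho> z \<otimes> \<rho> w)"
proof -
  interpret field F by fact
  define \<iota> where "\<iota> n = [n] \<cdot> \<one>" for n :: int
  have \<iota>_closed [simp]: "\<iota> n \<in> carrier F" for n
    by (simp add: \<iota>_def)
  have \<iota>_add: "\<iota> (n + m) = \<iota> n \<oplus> \<iota> m" for n m
    by (simp add: \<iota>_def add.int_pow_mult)
  have \<iota>_mult: "\<iota> (n * m) = \<iota> n \<otimes> \<iota> m" for n m
    using add.int_pow_pow[of \<one> n m] by (simp add: \<iota>_def add_pow_ldistr_int mult.commute[of n m])
  have \<iota>_0: "\<iota> 0 = \<zero>" and \<iota>_1: "\<iota> 1 = \<one>"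
    by (simp_all add: \<iota>_def add_pow_int_ge)
  have \<iota>_2: "\<iota> 2 = \<one> \<oplus> \<one>"
    using \<iota>_add[of 1 1] by (simp add: \<iota>_1)
  define half where "half = inv (\<one> \<oplus> \<one>)"
  have "\<one> \<oplus> \<one> \<in> Units F"
    using two by (simp add: field_Units)
  then have half [simp]: "half \<in> carrier F" and two_half: "\<iota> 2 \<otimes> half = \<one>"
    by (simp_all add: half_def \<iota>_2)
  \<comment> \<open>The intended image of \<open>n / 2 ^ k\<close>; cancelling powers of 2 does not
    change it, so the choice in \<open>\<rho>\<close> is harmless.\<close>
  define val where "val n k = \<iota> n \<otimes> half [^] k" for n :: int and k :: nat
  have val_closed [simp]: "val n k \<in> carrier F" for n k
    by (simp add: val_def)
  have val_add: "val (n + m) k = val n k \<oplus> val m k" for n m k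
    by (simp add: val_def \<iota>_add l_distr)
  have val_mult: "val (n * m) (k + l) = val n k \<otimes> val m l" for n m k l
    by (simp add: val_def \<iota>_mult nat_pow_mult[symmetric] m_ac)
  have "val 2 1 = \<one>"
    by (simp add: val_def two_half)
  then have val_2: "val (2 ^ l) l = \<one>" for l
  proof (induction l)
    case (Suc l)
    then show ?case
      using val_mult[of "2 ^ l" 2 l 1] by (simp add: mult.commute)
  qed (simp add: val_def \<iota>_1)
  have val_shift: "val (n * 2 ^ l) (k + l) = val n k" for n k l
    by (simp add: val_mult val_2)
  have val_eq: "val n k = val m l" if "complex_of_int n / 2 ^ k = of_int m / 2 ^ l" for n k m l
  proof -
    have "complex_of_int (n * 2 ^ l) = of_int (m * 2 ^ k)"
      using that by (simp add: field_simps)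
    then have "n * 2 ^ l = m * 2 ^ k"
      using of_int_eq_iff by blast
    then show ?thesis
      using val_shift[of n l k] val_shift[of m k l] by (simp add: add.commute)
  qed
  define \<rho> where "\<rho> z = (SOME y. \<exists>n k. z = of_int n / 2 ^ k \<and> y = val n k)" for z :: complex
  have \<rho>_val: "\<rho> (of_int n / 2 ^ k) = val n k" for n k
    unfolding \<rho>_def by (rule someI2[of _ "val n k"]) (blast, metis val_eq)
  have "\<rho> (z + w) = \<rho> z \<oplus> \<rho> w \<and> \<rho> (z * w) = \<rho> z \<otimes> \<rho> w" if D: "z \<in> D" "w \<in> D" for z w
  proof -
    obtain n k m l where zw: "z = of_int n / 2 ^ k" "w = of_int m / 2 ^ l"
      using D unfolding D_def by blast
    have "z + w = of_int (n * 2 ^ l + m * 2 ^ k) / 2 ^ (k + l)" "z * w = of_int (n * m) / 2 ^ (k + l)"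
      unfolding zw by (simp_all add: field_simps power_add)
    moreover have "val (m * 2 ^ k) (k + l) = val m l"
      using val_shift[of m k l] by (simp add: add.commute)
    ultimately have "\<rho> (z + w) = val n k \<oplus> val m l" "\<rho> (z * w) = val n k \<otimes> val m l"
      by (simp_all only: \<rho>_val val_add val_shift) (rule val_mult)
    then show ?thesis
      by (simp only: zw \<rho>_val)
  qed
  moreover have "\<rho> 0 = \<zero>" "\<rho> 1 = \<one>"
    using \<rho>_val[of 0 0] \<rho>_val[of 1 0] by (simp_all add: val_def \<iota>_0 \<iota>_1)
  moreover have "\<forall>z\<in>D. \<rho> z \<in> carrier F"
    by (auto simp: D_def \<rho>_val)
  ultimately show ?thesis
    by blast
qed

section \<open>Groups from roots of unity of prime order\<close>

text \<open>The element \<open>s * x ^ a * (1 + x) powi b\<close> of the overview: at coordinate 0,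
  \<open>x\<close> is 1 and \<open>1 + x\<close> is 2. A natural exponent \<open>a\<close> suffices
  for \<open>p > 0\<close>, since \<open>x\<close> has finite order.\<close>

definition cyclo_unit :: "nat \<Rightarrow> complex \<Rightarrow> nat \<Rightarrow> int \<Rightarrow> nat \<Rightarrow> complex" where
  "cyclo_unit p s a b n =
     s * (if n = 0 then 2 powi b else cis (2 * pi / real p) ^ a * (1 + cis (2 * pi / real p)) powi b)"

definition cyclo_group :: "nat \<Rightarrow> (nat \<Rightarrow> complex) set" where
  "cyclo_group p = {cyclo_unit p s a b | s a b. s \<in> {1, - 1}}"

lemma cis_power_eq_one_iff: "p > 0 \<Longrightarrow> cis (2 * pi / real p) ^ a = 1 \<longleftrightarrow> p dvd a"
  using cis_root_eq_one_iff[of p "int a"] by (simp add: DeMoivre mult_ac)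

lemma one_plus_cis_nonzero:
  assumes "odd p"
  shows "1 + cis (2 * pi / real p) \<noteq> 0"
proof
  assume "1 + cis (2 * pi / real p) = 0"
  then have "cis (2 * pi / real p) = - 1"
    by (simp add: add_eq_0_iff)
  then have "cis (2 * pi / real p) ^ p = - 1"
    using assms by simp
  moreover have "cis (2 * pi / real p) ^ p = 1"
    using assms by (subst cis_power_eq_one_iff) (auto intro: gr0I)
  ultimately show False by simp
qed

lemma cyclo_unit_mult:
  assumes "odd p"
  shows "cyclo_unit p s a b * cyclo_unit p s' a' b' = cyclo_unit p (s * s') (a + a') (b + b')"
  using one_plus_cis_nonzero[OF assms]
  by (auto simp: fun_eq_iff cyclo_unit_def power_add power_int_add)

lemma unit_group_cyclo:
  assumes "odd p"
  shows "unit_group (cyclo_group p)"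
proof -
  have p: "p > 0"
    using assms by (auto intro: gr0I)
  have unit: "cyclo_unit p s a b \<in> cyclo_group p" if "s = 1 \<or> s = - 1" for s a b
    using that by (auto simp: cyclo_group_def)
  have const: "cyclo_unit p s (p * a) 0 = (\<lambda>_. s)" for s a
    using p by (auto simp: fun_eq_iff cyclo_unit_def cis_power_eq_one_iff)
  have "1 \<in> cyclo_group p" "- 1 \<in> cyclo_group p"
    using unit[of 1 "p * 0" 0] unit[of "- 1" "p * 0" 0] unfolding const
    by (simp_all add: one_fun_def fun_Compl_def)
  moreover have "x * y \<in> cyclo_group p" if "x \<in> cyclo_group p" "y \<in> cyclo_group p" for x y
    using that by (auto simp: cyclo_group_def cyclo_unit_mult[OF assms]) (metis mult_1 mult_minus1)+
  moreover have "\<exists>y\<in>cyclo_group p. x * y = 1" if x_in: "x \<in> cyclo_group p" for x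
  proof -
    obtain s a b where x: "x = cyclo_unit p s a b" "s = 1 \<or> s = - 1"
      using x_in by (auto simp: cyclo_group_def)
    have "a + a * (p - 1) = p * a"
      using p by (simp add: algebra_simps diff_mult_distrib2)
    then have "x * cyclo_unit p s (a * (p - 1)) (- b) = (\<lambda>_. s * s)"
      unfolding x cyclo_unit_mult[OF assms] by (simp add: const)
    also have "\<dots> = 1"
      using x(2) by (auto simp: fun_eq_iff)
    finally show ?thesis
      using unit[OF x(2)] by blast
  qed
  ultimately show ?thesis
    unfolding unit_group_def by blast
qed

lemma norm_two_powi_eq: "cmod (2 powi b) = 2 ^ k \<longleftrightarrow> b = int k"
proof -
  have "cmod (2 powi b) = 2 powr b"
    by (simp add: norm_power_int powr_real_of_int')
  moreover have "(2::real) ^ k = 2 powr (real k)"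
    by (simp add: powr_realpow)
  moreover have "(2::real) powr (of_int b) = 2 powr (real k) \<longleftrightarrow> real_of_int b = real_of_int (int k)"
    by (simp add: powr_inj)
  ultimately show ?thesis
    by (simp only: of_int_eq_iff)
qed

lemma no_hom_between_cyclo:
  assumes p: "Factorial_Ring.prime p" "odd p" and q: "Factorial_Ring.prime q" "odd q" and "p \<noteq> q" and e: "inj e"
  shows "\<not> (ring_copy e, e ` cyclo_group q) \<succeq>\<^sub>H\<^sub>o\<^sub>m (ring_copy e, e ` cyclo_group p)"
proof
  interpret copied_ring e by standard fact
  have pos: "p > 0" "q > 0"
    using p q by (auto intro: gr0I)
  assume "(ring_copy e, e ` cyclo_group q) \<succeq>\<^sub>H\<^sub>o\<^sub>m (ring_copy e, e ` cyclo_group p)"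
  then obtain f where f: "\<And>a. a \<in> cyclo_group p \<Longrightarrow> f a \<in> cyclo_group q" "f 1 = 1"
    "\<And>a b. a \<in> cyclo_group p \<Longrightarrow> b \<in> cyclo_group p \<Longrightarrow> f (a * b) = f a * f b"
    "\<And>a b. a \<in> cyclo_group p \<Longrightarrow> b \<in> cyclo_group p \<Longrightarrow> a + b \<in> cyclo_group p \<Longrightarrow> f (a + b) = f a + f b"
    by (rule hom_ge_copyE[OF _ unit_group_cyclo[OF p(2)] unit_group_cyclo[OF q(2)]]) blast
  define x where "x = cyclo_unit p 1 1 0"
  have x: "x \<in> cyclo_group p" and one: "1 \<in> cyclo_group p"
    using unit_group_cyclo[OF p(2)] by (auto simp: x_def cyclo_group_def unit_group_def)
  have "1 + x = cyclo_unit p 1 0 1"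
    by (auto simp: fun_eq_iff x_def cyclo_unit_def)
  then have one_x: "1 + x \<in> cyclo_group p"
    by (auto simp: cyclo_group_def)
  have pow: "x ^ k \<in> cyclo_group p \<and> f (x ^ k) = f x ^ k" for k
    using unit_group_cyclo[OF p(2)] x
    by (induction k) (auto simp: one f(2,3) unit_group_def)
  have "x ^ p = 1"
    using pos by (auto simp: fun_eq_iff x_def cyclo_unit_def cis_power_eq_one_iff)
  then have fx_pow: "f x ^ p = 1"
    using pow[of p] f(2) by simp
  obtain s a b where fx: "f x = cyclo_unit q s a b" and s: "s = 1 \<or> s = - 1"
    using f(1)[OF x] by (auto simp: cyclo_group_def)
  \<comment> \<open>Coordinate 0 sees only the sign and a power of 2: taking moduli gives
    \<open>b = 0\<close>, and then oddness of \<open>p\<close> gives \<open>s = 1\<close>.\<close>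
  have at0: "(s * 2 powi b) ^ p = 1"
    using fun_cong[OF fx_pow, of 0] by (simp add: fx cyclo_unit_def)
  then have "cmod (2 powi b) ^ p = 1"
    using s by (metis mult_1 mult_minus1 norm_minus_cancel norm_one norm_power)
  then have "cmod (2 powi b) = 2 ^ 0"
    using pos power_eq_imp_eq_base[of "cmod (2 powi b)" p 1] by simp
  then have b: "b = 0"
    unfolding norm_two_powi_eq by simp
  have s1: "s = 1"
    using at0 s p(2) by (auto simp: b)
  \<comment> \<open>At coordinate 1 only a \<open>q\<close>-th root of unity is left, and its
    \<open>p\<close>-th power is 1; the distinct primes make it trivial.\<close>
  have "cis (2 * pi / real q) ^ (a * p) = 1"
    using fun_cong[OF fx_pow, of 1] by (simp add: fx cyclo_unit_def b s1 power_mult)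
  then have "q dvd a * p"
    using pos by (simp only: cis_power_eq_one_iff)
  then have "q dvd a"
    using p q \<open>p \<noteq> q\<close> by (metis prime_dvd_mult_iff primes_dvd_imp_eq)
  then have "f x = 1"
    using pos by (auto simp: fx b s1 fun_eq_iff cyclo_unit_def cis_power_eq_one_iff)
  \<comment> \<open>The relation expressing \<open>1 + x\<close> as an element is carried to
    \<open>1 + 1\<close>.\<close>
  then have "1 + 1 \<in> cyclo_group q"
    using f(1)[OF one_x] f(4)[OF one x one_x] f(2) by simp
  then obtain s' a' b' where two: "1 + 1 = cyclo_unit q s' a' b'" and s': "s' = 1 \<or> s' = - 1"
    by (auto simp: cyclo_group_def)
  have norm_s': "cmod s' = 1"
    using s' by auto
  \<comment> \<open>Coordinate 0 forces \<open>b' = 1\<close>; then coordinate 1 says that 1 plus a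
    root of unity has modulus 2, so that root is 1 and \<open>q dvd 1\<close>.\<close>
  have "s' * 2 powi b' = 2"
    using fun_cong[OF two, of 0] by (simp add: cyclo_unit_def)
  then have "cmod (2 powi b') = 2 ^ 1"
    using norm_s' by (metis mult_1 norm_mult norm_numeral power_one_right)
  then have "b' = 1"
    unfolding norm_two_powi_eq by simp
  then have "s' * (cis (2 * pi / real q) ^ a' * (1 + cis (2 * pi / real q))) = 2"
    using fun_cong[OF two, of 1] by (simp add: cyclo_unit_def)
  then have "cmod (s' * (cis (2 * pi / real q) ^ a' * (1 + cis (2 * pi / real q)))) = 2"
    by simp
  then have "cmod (1 + cis (2 * pi / real q)) = 2"
    using norm_s' by (simp add: norm_mult norm_power)
  then have "(cmod (1 + cis (2 * pi / real q)))\<^sup>2 = 4"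
    by simp
  then have "(1 + cos (2 * pi / real q))\<^sup>2 + (sin (2 * pi / real q))\<^sup>2 = 4"
    unfolding cmod_power2 by simp
  then have "cos (2 * pi / real q) = 1"
    using sin_cos_squared_add[of "2 * pi / real q"] by (simp add: power2_eq_square algebra_simps)
  then have "cis (2 * pi / real q) ^ 1 = 1"
    using sin_cos_squared_add[of "2 * pi / real q"] by (simp add: complex_eq_iff)
  then have "q dvd 1"
    using pos by (simp only: cis_power_eq_one_iff)
  then show False
    using q by simp
qed

text \<open>Reading coordinate 0 and applying \<open>\<rho>\<close> maps each group to the field.
  The bad sequence runs through the odd primes.\<close>

lemma not_wqo_char_neq_2:
  fixes F :: "'b ring" and e :: "(nat \<Rightarrow> complex) \<Rightarrow> 'a"
  assumes F: "field F" and two: "\<one>\<^bsub>F\<^esub> \<oplus>\<^bsub>F\<^esub> \<one>\<^bsub>F\<^esub> \<noteq> \<zero>\<^bsub>F\<^esub>" and e: "inj e"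
  shows "\<not> wqo_on (pf_over F :: 'a partial_field set) (\<succeq>\<^sub>H\<^sub>o\<^sub>m)"
proof -
  interpret F: field F by fact
  interpret copied_ring e by standard fact
  define D where "D = {complex_of_int n / 2 ^ k | n k. True}"
  obtain \<rho> where \<rho>: "\<rho> 0 = \<zero>\<^bsub>F\<^esub>" "\<rho> 1 = \<one>\<^bsub>F\<^esub>" "\<And>z. z \<in> D \<Longrightarrow> \<rho> z \<in> carrier F"
    "\<And>z w. z \<in> D \<Longrightarrow> w \<in> D \<Longrightarrow> \<rho> (z + w) = \<rho> z \<oplus>\<^bsub>F\<^esub> \<rho> w"
    "\<And>z w. z \<in> D \<Longrightarrow> w \<in> D \<Longrightarrow> \<rho> (z * w) = \<rho> z \<otimes>\<^bsub>F\<^esub> \<rho> w"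
    using dyadic_rationals_to_field[OF F two] unfolding D_def by blast
  have D0: "x 0 \<in> D" if "x \<in> insert 0 (cyclo_group p)" for x p
  proof -
    have "complex_of_int n * 2 powi b \<in> D" for n b
    proof (cases "b \<ge> 0")
      case True
      then have "complex_of_int n * 2 powi b = of_int (n * 2 ^ nat b) / 2 ^ 0"
        by (simp add: power_int_def)
      then show ?thesis unfolding D_def by blast
    next
      case False
      then have "complex_of_int n * 2 powi b = of_int n / 2 ^ nat (- b)"
        by (simp add: power_int_def field_simps)
      then show ?thesis unfolding D_def by blast
    qed
    \<comment> \<open>The numerators 0, 1 and -1 cover the zero element and the two signs.\<close>
    from this[of 0] this[of 1] this[of "- 1"] show ?thesis
      using that by (auto simp: cyclo_group_def cyclo_unit_def)
  qed
  have in_over: "(ring_copy e, e ` cyclo_group p) \<in> pf_over F" if odd: "odd p" for p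
  proof (rule copy_in_pf_over[OF F unit_group_cyclo[OF odd], where h = "\<lambda>x. \<rho> (x 0)"])
    fix x assume x: "x \<in> cyclo_group p"
    then obtain y where y: "y \<in> cyclo_group p" "x * y = 1"
      using unit_group_cyclo[OF odd] by (auto simp: unit_group_def)
    have "x 0 * y 0 = 1"
      using y(2) by (metis times_fun_apply one_fun_apply)
    then have "\<rho> (x 0) \<otimes>\<^bsub>F\<^esub> \<rho> (y 0) = \<one>\<^bsub>F\<^esub>"
      using \<rho>(5)[OF D0 D0, of x p y p] x y \<rho>(2) by simp
    then show "\<rho> (x 0) \<in> Units F"
      using \<rho>(3)[OF D0, of _ p] x y by (metis F.unit_factor F.Units_one_closed insertCI)
  next
    show "\<rho> ((x * y) 0) = \<rho> (x 0) \<otimes>\<^bsub>F\<^esub> \<rho> (y 0)" if "x \<in> cyclo_group p" "y \<in> cyclo_group p" for x y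
      using \<rho>(5)[OF D0 D0, of x p y p] that by simp
    show "\<rho> ((x + y) 0) = \<rho> (x 0) \<oplus>\<^bsub>F\<^esub> \<rho> (y 0)"
      if "x \<in> insert 0 (cyclo_group p)" "y \<in> insert 0 (cyclo_group p)" for x y
      using \<rho>(4)[OF D0 D0] that by simp
  qed (simp_all add: \<rho>(1,2))
  have inf: "infinite {p :: nat. Factorial_Ring.prime p \<and> odd p}"
  proof
    assume "finite {p :: nat. Factorial_Ring.prime p \<and> odd p}"
    then have "finite (insert 2 {p :: nat. Factorial_Ring.prime p \<and> odd p})"
      by simp
    moreover have "{p :: nat. Factorial_Ring.prime p} \<subseteq> insert 2 {p. Factorial_Ring.prime p \<and> odd p}"
      using primes_dvd_imp_eq[OF two_is_prime_nat] by auto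
    ultimately show False
      using primes_infinite finite_subset by blast
  qed
  define r where "r = enumerate {p :: nat. Factorial_Ring.prime p \<and> odd p}"
  have r: "Factorial_Ring.prime (r i)" "odd (r i)" for i
    using enumerate_in_set[OF inf, of i] by (auto simp: r_def)
  define a where "a i = (ring_copy e, e ` cyclo_group (r i))" for i
  have "range a \<subseteq> pf_over F"
    using in_over r(2) by (auto simp: a_def)
  moreover have "\<not> a i \<succeq>\<^sub>H\<^sub>o\<^sub>m a j" if "j < i" for i j
  proof -
    have "r j \<noteq> r i"
      using enumerate_mono[OF that inf] by (simp add: r_def)
    then show ?thesis
      unfolding a_def using r e by (intro no_hom_between_cyclo) auto
  qed
  ultimately show ?thesis
    unfolding wqo_on_def by blast
qed

theorem theorem3p12:
  fixes F :: "'b ring"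
  assumes "field F" and "finite (carrier F)"
    and universe_at_least_continuum: "\<exists>e :: nat set \<Rightarrow> 'a. inj e"
  shows "\<not> wqo_on (pf_over F :: 'a partial_field set) (\<succeq>\<^sub>H\<^sub>o\<^sub>m)"
proof -
  obtain e :: "nat set \<Rightarrow> 'a" where "inj e"
    using universe_at_least_continuum by blast
  \<comment> \<open>Complex sequences are coded by sets of naturals, so the universe contains a copy
    of their ring; whether \<open>1 + 1 = 0\<close> in the field decides which bad sequence
    applies.\<close>
  then have "\<exists>e :: (nat \<Rightarrow> complex) \<Rightarrow> 'a. inj e"
    using inj_compose[OF _ inj_nat_complex_code] by blast
  then show ?thesis
    using not_wqo_char_2 not_wqo_char_neq_2 assms(1) by blast
qed

end
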